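(* In dimensionless units $m=l=g=1$, for $(j_1,j_2)\ne(0,0)$ near $(0,0)$, the period $T=2\pi\,\partial I_1(h,j_2)/\partial h$ of the (symmetry reduced) motion of the spherical pendulum near its focus-focus point is $$T(j_1,j_2)=\frac{-\ln|\hat j|+S_1}{\partial\mathcal H/\partial j_1}=\frac{\ln\frac{32}{|\hat j|}+\frac3{16}j_1+O(2)}{1+\frac18j_1+O(2)},\qquad \hat j=j_1+\mathrm i j_2,\quad S_1=\frac{\partial S}{\partial j_1},$$ where $O(2)$ denotes terms of degree at least $2$ in $(j_1,j_2)$.
   Context: Spherical pendulum in dimensionless units: phase space $T^*S^2=\{(\mathbf r,\mathbf p)\in\mathbb R^3\times\mathbb R^3: \|\mathbf r\|=1,\ (\mathbf r,\mathbf p)=0\}$ with the symplectic form induced by $d\mathbf r\wedge d\mathbf p$, $H=\frac12\|\mathbf r\times\mathbf p\|^2+z-1$, second integral $L_z=xp_y-yp_x$. The unstable focus-focus equilibrium is $\mathbf r=(0,0,1)$, $\mathbf p=0$, with $H=0$. Eliasson coordinates: there are analytic symplectic coordinates $(q_1,q_2,p_1,p_2)$ near this equilibrium (centred at it) in which $L_z=J_2$ and $H=\mathcal H(J_1,J_2)$ with $J_1=q_1p_1+q_2p_2$, $J_2=q_1p_2-q_2p_1$ and $\mathcal H=J_1+O(2)$ (Birkhoff normal form). Values of $J_1,J_2$ are denoted $j_1,j_2$, and $h=\mathcal H(j_1,j_2)$ is the energy. The canonical action, as a function of $(h,j_2)$, is $$I_1(h,j_2)=\frac1\pi\int_{\zeta_0}^{\zeta_1}\frac{\sqrt{P(\zeta)}}{1-\zeta^2}\,d\zeta,\qquad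 P(\zeta)=2(1-\zeta^2)(h+1-\zeta)-j_2^2,$$ where $-1\le\zeta_0\le\zeta_1\le1\le\zeta_2$ are the roots of $P$. The derivative defining $T$ is taken at fixed $j_2$, and $T$ is then expressed in $(j_1,j_2)$ via $h=\mathcal H(j_1,j_2)$. $\mathrm{Arg}$ is the principal argument. The semi-global symplectic invariant $S(j_1,j_2)$ is the regular (power series) function defined by $$2\pi I_1=8-2\pi|j_2|+j_2\,\mathrm{Arg}\,\hat j-j_1\ln|\hat j|+j_1+S(j_1,j_2).$$ *)

theory Defs
  imports "HOL-Analysis.Analysis"
begin

section \<open>Real-analytic maps of several variables\<close>

text \<open>
  The library only has analyticity for functions of one complex variable.  A multi-index is a
  function from the basis to the naturals (extended by \<^const>\<open>undefined\<close> outside the basis), and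
  the power series is summed unconditionally.
\<close>

definition has_power_series ::
  "('a::euclidean_space \<Rightarrow> 'b::real_normed_vector) \<Rightarrow> (('a \<Rightarrow> nat) \<Rightarrow> 'b) \<Rightarrow> 'a \<Rightarrow> bool" where
  "has_power_series f c x \<longleftrightarrow>
     (\<forall>\<^sub>F y in nhds x.
        ((\<lambda>\<alpha>. (\<Prod>b\<in>Basis. ((y - x) \<bullet> b) ^ \<alpha> b) *\<^sub>R c \<alpha>) has_sum f y) (Basis \<rightarrow>\<^sub>E UNIV))"

definition real_analytic_at ::
  "('a::euclidean_space \<Rightarrow> 'b::real_normed_vector) \<Rightarrow> 'a \<Rightarrow> bool" where
  "real_analytic_at f x \<longleftrightarrow> (\<exists>c. has_power_series f c x)"

text \<open>\<open>bigO_deg n f\<close>: near the origin, \<open>f\<close> is a convergent power series all of whose terms have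
  degree at least \<open>n\<close>, i.e. \<open>f = O(n)\<close>.\<close>

definition bigO_deg :: "nat \<Rightarrow> ('a::euclidean_space \<Rightarrow> real) \<Rightarrow> bool" where
  "bigO_deg n f \<longleftrightarrow>
     (\<exists>c. has_power_series f c 0 \<and>
          (\<forall>\<alpha>\<in>Basis \<rightarrow>\<^sub>E UNIV. (\<Sum>b\<in>Basis. \<alpha> b) < n \<longrightarrow> c \<alpha> = 0))"

definition partial1 :: "(real \<times> real \<Rightarrow> real) \<Rightarrow> real \<times> real \<Rightarrow> real" where
  "partial1 f j = deriv (\<lambda>x. f (x, snd j)) (fst j)"

section \<open>The spherical pendulum\<close>

definition TS2 :: "((real^3) \<times> (real^3)) set" where
  "TS2 = {(r, p). norm r = 1 \<and> r \<bullet> p = 0}"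

text \<open>The form \<open>dr \<and> dp\<close>; used both on \<open>\<real>\<^sup>3 \<times> \<real>\<^sup>3\<close> (restricted to tangent vectors of \<^const>\<open>TS2\<close>)
  and, as \<open>dq \<and> dp\<close>, on \<open>\<real>\<^sup>2 \<times> \<real>\<^sup>2\<close>.\<close>

definition canonical_form :: "'a::real_inner \<times> 'a \<Rightarrow> 'a \<times> 'a \<Rightarrow> real" where
  "canonical_form u v = fst u \<bullet> snd v - snd u \<bullet> fst v"

definition energy :: "(real^3) \<times> (real^3) \<Rightarrow> real" where
  "energy = (\<lambda>(r, p). (norm (cross3 r p))\<^sup>2 / 2 + r $ 3 - 1)"

definition ang_mom_z :: "(real^3) \<times> (real^3) \<Rightarrow> real" where
  "ang_mom_z = (\<lambda>(r, p). r $ 1 * p $ 2 - r $ 2 * p $ 1)"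

definition equilibrium :: "(real^3) \<times> (real^3)" where
  "equilibrium = (vector [0, 0, 1], 0)"

section \<open>Eliasson coordinates\<close>

definition J1 :: "(real^2) \<times> (real^2) \<Rightarrow> real" where
  "J1 = (\<lambda>(q, p). q $ 1 * p $ 1 + q $ 2 * p $ 2)"

definition J2 :: "(real^2) \<times> (real^2) \<Rightarrow> real" where
  "J2 = (\<lambda>(q, p). q $ 1 * p $ 2 - q $ 2 * p $ 1)"

text \<open>
  \<open>\<Phi>\<close> is the local parametrisation of the phase space by \<open>(q, p) \<in> U\<close>, i.e. the inverse of the
  coordinate chart.  That this inverse is analytic as well follows from the conditions below,
  since a symplectic map is an immersion.
\<close>

definition eliasson_coordinates ::
  "((real^2) \<times> (real^2)) set \<Rightarrow> ((real^2) \<times> (real^2) \<Rightarrow> (real^3) \<times> (real^3)) \<Rightarrow>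
     (real \<times> real \<Rightarrow> real) \<Rightarrow> bool" where
  "eliasson_coordinates U \<Phi> \<H> \<longleftrightarrow>
     open U \<and> 0 \<in> U \<and> \<Phi> 0 = equilibrium \<and>
     inj_on \<Phi> U \<and> openin (top_of_set TS2) (\<Phi> ` U) \<and>
     (\<forall>x\<in>U. real_analytic_at \<Phi> x) \<and>
     (\<forall>x\<in>U. \<exists>D. (\<Phi> has_derivative D) (at x) \<and>
                (\<forall>u v. canonical_form (D u) (D v) = canonical_form u v)) \<and>
     (\<forall>x\<in>U. ang_mom_z (\<Phi> x) = J2 x) \<and>
     (\<forall>x\<in>U. energy (\<Phi> x) = \<H> (J1 x, J2 x)) \<and>
     bigO_deg 2 (\<lambda>j. \<H> j - fst j)"

section \<open>Action, period and semi-global symplectic invariant\<close>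

definition cubic :: "real \<Rightarrow> real \<Rightarrow> real \<Rightarrow> real" where
  "cubic h j2 \<zeta> = 2 * (1 - \<zeta>\<^sup>2) * (h + 1 - \<zeta>) - j2\<^sup>2"

text \<open>The roots of the cubic polynomial are counted with multiplicity; the triple is unique if it exists, and it
  exists for all \<open>(h, j2)\<close> near the origin.\<close>

definition are_roots :: "real \<Rightarrow> real \<Rightarrow> real \<times> real \<times> real \<Rightarrow> bool" where
  "are_roots h j2 = (\<lambda>(\<zeta>0, \<zeta>1, \<zeta>2).
     - 1 \<le> \<zeta>0 \<and> \<zeta>0 \<le> \<zeta>1 \<and> \<zeta>1 \<le> 1 \<and> 1 \<le> \<zeta>2 \<and>
     (\<forall>\<zeta>. cubic h j2 \<zeta> = 2 * (\<zeta> - \<zeta>0) * (\<zeta> - \<zeta>1) * (\<zeta> - \<zeta>2)))"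

definition I1 :: "real \<Rightarrow> real \<Rightarrow> real" where
  "I1 h j2 =
     (let (\<zeta>0, \<zeta>1, \<zeta>2) = (THE z. are_roots h j2 z)
      in 1 / pi * integral {\<zeta>0..\<zeta>1} (\<lambda>\<zeta>. sqrt (cubic h j2 \<zeta>) / (1 - \<zeta>\<^sup>2)))"

definition jhat :: "real \<times> real \<Rightarrow> complex" where
  "jhat j = Complex (fst j) (snd j)"

definition period :: "(real \<times> real \<Rightarrow> real) \<Rightarrow> real \<times> real \<Rightarrow> real" where
  "period \<H> j = 2 * pi * deriv (\<lambda>h. I1 h (snd j)) (\<H> j)"

definition semi_global_invariant ::
  "(real \<times> real \<Rightarrow> real) \<Rightarrow> (real \<times> real \<Rightarrow> real) \<Rightarrow> bool" where
  "semi_global_invariant \<H> S \<longleftrightarrow>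
     real_analytic_at S 0 \<and>
     (\<forall>\<^sub>F (j1, j2) in at 0.
        2 * pi * I1 (\<H> (j1, j2)) j2 =
          8 - 2 * pi * \<bar>j2\<bar> + j2 * Arg (jhat (j1, j2)) - j1 * ln (norm (jhat (j1, j2)))
            + j1 + S (j1, j2))"

end

theory Submission
  imports Defs "HOL-Real_Asymp.Real_Asymp"
begin

text \<open>
  Write \<open>W j = 8 - 2\<pi>\<bar>j2\<bar> + j2 Arg \<hat>j - j1 ln \<bar>\<hat>j\<bar> + j1 + S j\<close>, so that \<open>2\<pi> I1 (\<H> j) j2 = W j\<close>.  Differentiating at
  fixed \<open>j2\<close> gives the first formula for \<open>T\<close>: the \<open>j1\<close>-derivative of the explicit part of \<open>W\<close> is exactly
  \<open>- ln \<bar>\<hat>j\<bar>\<close>, and \<open>\<partial>\<H>/\<partial>j1\<close> is close to \<open>1\<close>, so \<open>\<H>(\<cdot>, j2)\<close> can be inverted locally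
  (\<open>DERIV_factor_through_inverse\<close>); this also yields the differentiability of \<open>I1\<close>.

  What remains is to find the Taylor coefficients of \<open>\<H>\<close> and \<open>S\<close> of degree at most two that enter the
  first-order parts of \<open>\<partial>\<H>/\<partial>j1\<close> and \<open>\<partial>S/\<partial>j1\<close>.  The identity \<open>2\<pi> I1 (\<H> j) j2 = W j\<close> determines them:
  \<open>\<H>\<close> affects the coefficient of \<open>t\<^sup>2 ln t\<close> along curves into the origin, \<open>S\<close> does not, and \<open>t\<^sup>2 ln t\<close> is
  independent of \<open>1, t, t\<^sup>2\<close> modulo \<open>o(t\<^sup>2)\<close>.

  The coefficients of \<open>j1\<close> and \<open>j1\<^sup>2\<close> are read off on the axis \<open>j2 = 0\<close> (\<open>coeffs_on_axis\<close>).  There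
  \<open>2\<pi> I1 h 0 = 8 F(h/2)\<close> for \<open>h > 0\<close>, with \<open>F m = \<integral> sqrt (m + sin\<^sup>2 u) du\<close> over \<open>[0, \<pi>/2]\<close>, and \<open>F\<close> solves
  \<open>m (1 + m) F'' + F / 4 = 0\<close>.  This equation together with \<open>F 0 = 1\<close> and \<open>F' m + ln m / 4 \<rightarrow> ln 2\<close> determines
  the expansion of \<open>F\<close> up to \<open>o(m\<^sup>2)\<close> (\<open>ell0_second_order\<close>); the constant \<open>ln 2\<close> here is what becomes the
  \<open>32\<close> in the theorem.

  The coefficients of \<open>j1 j2\<close> vanish (\<open>coeffs_off_axis\<close>) because \<open>I1\<close> is even in \<open>j2\<close>: the point \<open>(t, t)\<close> is
  compared with the point \<open>(v, -t)\<close> of the same energy, where \<open>v = t + O(t\<^sup>2)\<close>.  Both comparisons move a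
  point along a horizontal line and use the increment of the singular part of \<open>W\<close> along it
  (\<open>singular_action_increment\<close>).
\<close>

section \<open>Power series in two real variables\<close>

text \<open>The multi-indices of \<^const>\<open>has_power_series\<close> are replaced by pairs of naturals, which makes iterated
  summation and shifts of the index available.\<close>

definition power_series2 :: "(nat \<times> nat \<Rightarrow> real) \<Rightarrow> (real \<times> real \<Rightarrow> real) \<Rightarrow> bool" where
  "power_series2 a f \<longleftrightarrow>
     (\<forall>\<^sub>F z in nhds 0. ((\<lambda>(m, n). a (m, n) * fst z ^ m * snd z ^ n) has_sum f z) UNIV)"

lemma Basis_real_prod: "(Basis :: (real \<times> real) set) = {(1, 0), (0, 1)}"
  by (auto simp: Basis_prod_def)

definition multi_index :: "nat \<times> nat \<Rightarrow> real \<times> real \<Rightarrow> nat" where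
  "multi_index p = restrict (\<lambda>b. if b = (1, 0) then fst p else snd p) Basis"

lemma multi_index_simps [simp]:
  "multi_index p (1, 0) = fst p" "multi_index p (0, 1) = snd p"
  by (simp_all add: multi_index_def Basis_real_prod)

lemma multi_index_mem: "multi_index p \<in> Basis \<rightarrow>\<^sub>E UNIV"
  by (simp add: multi_index_def)

lemma multi_index_inverse:
  assumes "\<alpha> \<in> (Basis :: (real \<times> real) set) \<rightarrow>\<^sub>E UNIV"
  shows "multi_index (\<alpha> (1, 0), \<alpha> (0, 1)) = \<alpha>"
proof
  fix b
  show "multi_index (\<alpha> (1, 0), \<alpha> (0, 1)) b = \<alpha> b"
    using PiE_arb[OF assms, of b]
    by (cases "b \<in> Basis") (auto simp: multi_index_def Basis_real_prod)
qed

lemma bij_betw_multi_index: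
  "bij_betw multi_index UNIV ((Basis :: (real \<times> real) set) \<rightarrow>\<^sub>E UNIV)"
proof (rule bij_betw_byWitness[where f' = "\<lambda>\<alpha>. (\<alpha> (1, 0), \<alpha> (0, 1))"])
  show "\<forall>\<alpha>\<in>Basis \<rightarrow>\<^sub>E UNIV. multi_index (\<alpha> (1, 0), \<alpha> (0, 1)) = \<alpha>"
    using multi_index_inverse by blast
  show "range multi_index \<subseteq> Basis \<rightarrow>\<^sub>E UNIV"
    using multi_index_mem by blast
qed simp_all

lemma has_power_series_iff_power_series2:
  "has_power_series f c 0 \<longleftrightarrow> power_series2 (c \<circ> multi_index) f"
proof -
  have "((\<lambda>\<alpha>. (\<Prod>b\<in>Basis. ((y - 0) \<bullet> b) ^ \<alpha> b) *\<^sub>R c \<alpha>) has_sum f y) (Basis \<rightarrow>\<^sub>E UNIV) \<longleftrightarrow>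
        ((\<lambda>(m, n). (c \<circ> multi_index) (m, n) * fst y ^ m * snd y ^ n) has_sum f y) UNIV"
    for y :: "real \<times> real"
  proof -
    have eq: "(\<Prod>b\<in>Basis. ((y - 0) \<bullet> b) ^ multi_index p b) *\<^sub>R c (multi_index p) =
          (\<lambda>(m, n). (c \<circ> multi_index) (m, n) * fst y ^ m * snd y ^ n) p" for p
      by (cases p) (simp add: Basis_real_prod inner_prod_def)
    show ?thesis
      by (subst has_sum_reindex_bij_betw[OF bij_betw_multi_index, symmetric]) (simp only: eq)
  qed
  then show ?thesis
    by (simp only: has_power_series_def power_series2_def)
qed

lemma power_series2_imp_has_power_series:
  assumes "power_series2 a f"
  shows "has_power_series f (\<lambda>\<alpha>. a (\<alpha> (1, 0), \<alpha> (0, 1))) 0"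
proof -
  have "(\<lambda>\<alpha>. a (\<alpha> (1, 0), \<alpha> (0, 1))) \<circ> multi_index = a"
    by (simp add: fun_eq_iff)
  with assms show ?thesis
    by (simp only: has_power_series_iff_power_series2)
qed

lemma real_analytic_at_0_iff: "real_analytic_at f 0 \<longleftrightarrow> (\<exists>a. power_series2 a f)"
  unfolding real_analytic_at_def
  using has_power_series_iff_power_series2 power_series2_imp_has_power_series by blast

lemma bigO_deg_iff:
  "bigO_deg k f \<longleftrightarrow> (\<exists>a. power_series2 a f \<and> (\<forall>m n. m + n < k \<longrightarrow> a (m, n) = 0))"
proof
  assume "bigO_deg k f"
  then obtain c where c: "has_power_series f c 0"
    "\<forall>\<alpha>\<in>Basis \<rightarrow>\<^sub>E UNIV. (\<Sum>b\<in>Basis. \<alpha> b) < k \<longrightarrow> c \<alpha> = 0"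
    unfolding bigO_deg_def by blast
  have "(c \<circ> multi_index) (m, n) = 0" if "m + n < k" for m n
    using c(2)[rule_format, OF multi_index_mem, of "(m, n)"] that by (simp add: Basis_real_prod)
  with c(1) show "\<exists>a. power_series2 a f \<and> (\<forall>m n. m + n < k \<longrightarrow> a (m, n) = 0)"
    unfolding has_power_series_iff_power_series2 by blast
next
  assume "\<exists>a. power_series2 a f \<and> (\<forall>m n. m + n < k \<longrightarrow> a (m, n) = 0)"
  then obtain a where a: "power_series2 a f" "\<forall>m n. m + n < k \<longrightarrow> a (m, n) = 0" by blast
  show "bigO_deg k f"
    unfolding bigO_deg_def
    using power_series2_imp_has_power_series[OF a(1)] a(2)
    by (intro exI[of _ "\<lambda>\<alpha>. a (\<alpha> (1, 0), \<alpha> (0, 1))"]) (simp add: Basis_real_prod)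
qed

lemma power_series2_add:
  assumes "power_series2 a f" "power_series2 b g"
  shows "power_series2 (\<lambda>p. a p + b p) (\<lambda>z. f z + g z)"
  using assms unfolding power_series2_def
  by eventually_elim (drule (1) has_sum_add, simp add: case_prod_unfold algebra_simps)

lemma power_series2_monomial:
  "power_series2 (\<lambda>p. if p = (i, j) then k else 0) (\<lambda>z. k * fst z ^ i * snd z ^ j)"
  unfolding power_series2_def
  by (intro always_eventually allI has_sum_finite_neutralI[where B = "{(i, j)}"])
     (auto split: if_splits)

lemma eventually_nhds_0_box:
  "(\<forall>\<^sub>F z in nhds (0 :: real \<times> real). P z) \<longleftrightarrow>
     (\<exists>r>0. \<forall>x y. \<bar>x\<bar> \<le> r \<longrightarrow> \<bar>y\<bar> \<le> r \<longrightarrow> P (x, y))"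
proof
  assume "\<forall>\<^sub>F z in nhds (0 :: real \<times> real). P z"
  then obtain e where e: "e > 0" "\<And>z. norm z < e \<Longrightarrow> P z"
    unfolding eventually_nhds_metric by (auto simp: dist_norm)
  have "P (x, y)" if "\<bar>x\<bar> \<le> e / 3" "\<bar>y\<bar> \<le> e / 3" for x y
    using that e(1) norm_Pair_le[of x y] by (intro e(2)) auto
  moreover have "e / 3 > 0" using e(1) by simp
  ultimately show "\<exists>r>0. \<forall>x y. \<bar>x\<bar> \<le> r \<longrightarrow> \<bar>y\<bar> \<le> r \<longrightarrow> P (x, y)"
    by blast
next
  assume "\<exists>r>0. \<forall>x y. \<bar>x\<bar> \<le> r \<longrightarrow> \<bar>y\<bar> \<le> r \<longrightarrow> P (x, y)"
  then obtain r where r: "r > 0" "\<And>x y. \<bar>x\<bar> \<le> r \<Longrightarrow> \<bar>y\<bar> \<le> r \<Longrightarrow> P (x, y)" by blast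
  have "P z" if "norm z < r" for z
    using r(2)[of "fst z" "snd z"] that norm_fst_le[of "fst z" "snd z"] norm_snd_le[of "snd z" "fst z"]
    by simp
  then show "\<forall>\<^sub>F z in nhds (0 :: real \<times> real). P z"
    unfolding eventually_nhds_metric using r(1) by (auto simp: dist_norm)
qed

lemma power_series2E:
  assumes "power_series2 a f"
  obtains r where "r > 0"
    "\<And>x y. \<bar>x\<bar> \<le> r \<Longrightarrow> \<bar>y\<bar> \<le> r \<Longrightarrow> ((\<lambda>(m, n). a (m, n) * x ^ m * y ^ n) has_sum f (x, y)) UNIV"
    "(\<lambda>(m, n). \<bar>a (m, n)\<bar> * r ^ m * r ^ n) summable_on UNIV"
proof -
  obtain r where r: "r > 0"
    "\<And>x y. \<bar>x\<bar> \<le> r \<Longrightarrow> \<bar>y\<bar> \<le> r \<Longrightarrow> ((\<lambda>(m, n). a (m, n) * x ^ m * y ^ n) has_sum f (x, y)) UNIV"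
    using assms unfolding power_series2_def eventually_nhds_0_box fst_conv snd_conv by blast
  have "(\<lambda>(m, n). a (m, n) * r ^ m * r ^ n) summable_on UNIV"
    using r(2)[of r r] r(1) unfolding summable_on_def by auto
  then have "(\<lambda>p. norm ((\<lambda>(m, n). a (m, n) * r ^ m * r ^ n) p)) summable_on UNIV"
    by (rule summable_on_iff_abs_summable_on_real[THEN iffD1])
  also have "(\<lambda>p. norm ((\<lambda>(m, n). a (m, n) * r ^ m * r ^ n) p)) =
             (\<lambda>(m, n). \<bar>a (m, n)\<bar> * r ^ m * r ^ n)"
    using r(1) by (auto simp: fun_eq_iff abs_mult)
  finally have "(\<lambda>(m, n). \<bar>a (m, n)\<bar> * r ^ m * r ^ n) summable_on UNIV" .
  with r that show ?thesis by presburger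
qed

text \<open>Pulling \<open>q = max \<bar>x\<bar> \<bar>y\<bar> / r\<close> out of every factor bounds a term of degree at least \<open>N\<close> by \<open>q\<^sup>N\<close> times
  its modulus at the corner \<open>(r, r)\<close>, where the series converges absolutely.\<close>

lemma power_series2_remainder:
  assumes "power_series2 a f"
  obtains r C where "r > 0"
    "\<And>x y. \<bar>x\<bar> \<le> r \<Longrightarrow> \<bar>y\<bar> \<le> r \<Longrightarrow>
       \<bar>f (x, y) - (\<Sum>(m, n) | m + n < N. a (m, n) * x ^ m * y ^ n)\<bar> \<le> C * max \<bar>x\<bar> \<bar>y\<bar> ^ N"
proof -
  obtain r where r: "r > 0"
    "\<And>x y. \<bar>x\<bar> \<le> r \<Longrightarrow> \<bar>y\<bar> \<le> r \<Longrightarrow> ((\<lambda>(m, n). a (m, n) * x ^ m * y ^ n) has_sum f (x, y)) UNIV"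
    "(\<lambda>(m, n). \<bar>a (m, n)\<bar> * r ^ m * r ^ n) summable_on UNIV"
    using power_series2E[OF assms] by blast
  define A where "A = {(m :: nat, n). m + n < N}"
  have "A \<subseteq> {..N} \<times> {..N}" by (auto simp: A_def)
  then have fin: "finite A" by (rule finite_subset) auto
  define M where "M = infsum (\<lambda>(m, n). \<bar>a (m, n)\<bar> * r ^ m * r ^ n) (- A)"
  have M: "((\<lambda>(m, n). \<bar>a (m, n)\<bar> * r ^ m * r ^ n) has_sum M) (- A)"
    unfolding M_def by (intro has_sum_infsum summable_on_subset_banach[OF r(3)]) auto
  have "\<bar>f (x, y) - (\<Sum>(m, n) | m + n < N. a (m, n) * x ^ m * y ^ n)\<bar> \<le> M / r ^ N * max \<bar>x\<bar> \<bar>y\<bar> ^ N"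
    if xy: "\<bar>x\<bar> \<le> r" "\<bar>y\<bar> \<le> r" for x y
  proof -
    define g where "g = (\<lambda>(m, n). a (m, n) * x ^ m * y ^ n)"
    define q where "q = max \<bar>x\<bar> \<bar>y\<bar> / r"
    have q: "0 \<le> q" "q \<le> 1" "\<bar>x\<bar> \<le> q * r" "\<bar>y\<bar> \<le> q * r" using xy r(1) by (auto simp: q_def)
    have "(g has_sum (f (x, y) - sum g A)) (UNIV - A)"
      using r(2)[OF xy] fin unfolding g_def[symmetric]
      by (intro has_sum_Diff) auto
    then have g: "(g has_sum (f (x, y) - sum g A)) (- A)" by (simp add: Compl_eq_Diff_UNIV)
    define t where "t = (\<lambda>(m, n). \<bar>a (m, n)\<bar> * r ^ m * r ^ n)"
    have bound: "\<bar>g p\<bar> \<le> q ^ N * t p" if "p \<in> - A" for p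
    proof (cases p)
      case (Pair m n)
      have "\<bar>x\<bar> ^ m * \<bar>y\<bar> ^ n \<le> (q * r) ^ m * (q * r) ^ n"
        using q r(1) by (intro mult_mono power_mono) auto
      also have "\<dots> = q ^ (m + n) * (r ^ m * r ^ n)"
        by (simp add: power_add power_mult_distrib mult_ac)
      also have "\<dots> \<le> q ^ N * (r ^ m * r ^ n)"
        using that Pair q r(1) by (intro mult_right_mono power_decreasing) (auto simp: A_def)
      finally have "\<bar>a (m, n)\<bar> * (\<bar>x\<bar> ^ m * \<bar>y\<bar> ^ n) \<le> \<bar>a (m, n)\<bar> * (q ^ N * (r ^ m * r ^ n))"
        by (rule mult_left_mono) auto
      then show ?thesis
        by (simp add: Pair g_def t_def abs_mult power_abs mult_ac)
    qed
    have t: "((\<lambda>p. q ^ N * t p) has_sum (q ^ N * M)) (- A)"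
      using M unfolding t_def[symmetric] by (rule has_sum_cmult_right)
    have "f (x, y) - sum g A \<le> q ^ N * M"
      by (rule has_sum_mono[OF g t]) (rule abs_le_D1[OF bound])
    moreover have "- (f (x, y) - sum g A) \<le> q ^ N * M"
    proof (rule has_sum_mono[OF _ t])
      show "((\<lambda>p. - g p) has_sum - (f (x, y) - sum g A)) (- A)"
        using g by (simp only: has_sum_uminus minus_minus)
    qed (rule abs_le_D2[OF bound])
    ultimately have "\<bar>f (x, y) - sum g A\<bar> \<le> q ^ N * M" by linarith
    moreover have "sum g A = (\<Sum>(m, n) | m + n < N. a (m, n) * x ^ m * y ^ n)"
      by (simp add: A_def g_def case_prod_beta)
    ultimately show ?thesis
      by (simp add: q_def power_divide mult_ac)
  qed
  then show ?thesis by (rule that[OF r(1)])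
qed

text \<open>For fixed \<open>y\<close> the double series is an ordinary power series in \<open>x\<close>, whose coefficients are the inner
  sums, so the derivative exists by the one-variable theorem.  The differentiated double series converges
  because a factor \<open>m + 1\<close> is absorbed by the geometric decay of \<open>(\<bar>x\<bar> / r)\<^sup>m\<close>; summing it by rows
  identifies it with the derivative.\<close>

lemma power_series2_partial1:
  assumes "power_series2 a f"
  shows "power_series2 (\<lambda>(m, n). real (Suc m) * a (Suc m, n)) (partial1 f)"
    and "\<forall>\<^sub>F z in nhds 0. ((\<lambda>x. f (x, snd z)) has_real_derivative partial1 f z) (at (fst z))"
proof -
  obtain r where r: "r > 0"
    "\<And>x y. \<bar>x\<bar> \<le> r \<Longrightarrow> \<bar>y\<bar> \<le> r \<Longrightarrow> ((\<lambda>(m, n). a (m, n) * x ^ m * y ^ n) has_sum f (x, y)) UNIV"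
    "(\<lambda>(m, n). \<bar>a (m, n)\<bar> * r ^ m * r ^ n) summable_on UNIV"
    using power_series2E[OF assms] by blast
  define d where "d = (\<lambda>(m, n). real (Suc m) * a (Suc m, n))"
  have main: "((\<lambda>x. f (x, y)) has_real_derivative partial1 f (x, y)) (at x) \<and>
              ((\<lambda>(m, n). d (m, n) * x ^ m * y ^ n) has_sum partial1 f (x, y)) UNIV"
    if xy: "\<bar>x\<bar> < r" "\<bar>y\<bar> \<le> r" for x y
  proof -
    have inner: "(\<lambda>n. a (m, n) * y ^ n) summable_on UNIV" for m
    proof -
      have "(\<lambda>(m, n). a (m, n) * r ^ m * y ^ n) summable_on (UNIV \<times> UNIV)"
        using r(2)[of r y] r(1) xy by (auto simp: summable_on_def)
      then have "(\<lambda>n. a (m, n) * r ^ m * y ^ n) summable_on UNIV"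
        by (rule summable_on_SigmaD1) auto
      then have "(\<lambda>n. (1 / r ^ m) * (a (m, n) * r ^ m * y ^ n)) summable_on UNIV"
        by (rule summable_on_cmult_right)
      then show ?thesis using r(1) by simp
    qed
    define b where "b m = infsum (\<lambda>n. a (m, n) * y ^ n) UNIV" for m
    have b: "((\<lambda>n. a (m, n) * y ^ n) has_sum b m) UNIV" for m
      unfolding b_def by (rule has_sum_infsum[OF inner])
    have f_sums: "(\<lambda>m. b m * u ^ m) sums f (u, y)" if u: "\<bar>u\<bar> \<le> r" for u
    proof (rule has_sum_imp_sums, rule has_sum_Sigma')
      show "((\<lambda>(m, n). a (m, n) * u ^ m * y ^ n) has_sum f (u, y)) (UNIV \<times> UNIV)"
        using r(2)[OF u xy(2)] by simp
      show "((\<lambda>n. case (m, n) of (m, n) \<Rightarrow> a (m, n) * u ^ m * y ^ n) has_sum b m * u ^ m) UNIV" for m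
        using has_sum_cmult_left[OF b[of m], of "u ^ m"] by (simp add: mult_ac)
    qed
    define D where "D = (\<Sum>m. diffs b m * x ^ m)"
    have "summable (\<lambda>m. b m * r ^ m)"
      using f_sums[of r] r(1) by (auto simp: sums_iff)
    then have "((\<lambda>x. \<Sum>m. b m * x ^ m) has_real_derivative D) (at x)"
      unfolding D_def by (rule termdiffs_strong) (use xy r(1) in auto)
    then have deriv: "((\<lambda>x. f (x, y)) has_real_derivative D) (at x)"
      by (rule has_field_derivative_transform_within_open[where S = "{-r<..<r}"])
         (use xy f_sums in \<open>auto simp: sums_iff abs_less_iff abs_le_iff\<close>)
    then have D: "partial1 f (x, y) = D"
      by (simp add: partial1_def DERIV_imp_deriv)
    have "(\<lambda>n. real n * (\<bar>x\<bar> / r) ^ n + (\<bar>x\<bar> / r) ^ n) \<longlonglongrightarrow> 0 + 0"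
      using xy r(1) by (intro tendsto_add powser_times_n_limit_0 LIMSEQ_power_zero) auto
    then have "Bseq (\<lambda>n. real n * (\<bar>x\<bar> / r) ^ n + (\<bar>x\<bar> / r) ^ n)"
      by (intro convergent_imp_Bseq convergentI)
    then have "Bseq (\<lambda>n. real (Suc n) * (\<bar>x\<bar> / r) ^ n)"
      by (simp add: algebra_simps)
    then obtain K where "\<And>n. norm (real (Suc n) * (\<bar>x\<bar> / r) ^ n) \<le> K"
      unfolding Bseq_def by blast
    then have K: "real (Suc n) * \<bar>x\<bar> ^ n \<le> K * r ^ n" for n
      using r(1) by (simp add: power_divide field_simps abs_mult)
    have "(\<lambda>p. (\<lambda>(m, n). \<bar>a (m, n)\<bar> * r ^ m * r ^ n) (case p of (m, n) \<Rightarrow> (Suc m, n))) summable_on UNIV"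
    proof -
      have "inj (\<lambda>(m :: nat, n :: nat). (Suc m, n))" by (auto simp: inj_def)
      moreover have "(\<lambda>(m, n). \<bar>a (m, n)\<bar> * r ^ m * r ^ n) summable_on range (\<lambda>(m, n). (Suc m, n))"
        by (rule summable_on_subset_banach[OF r(3)]) auto
      ultimately show ?thesis by (subst (asm) summable_on_reindex) (auto simp: o_def)
    qed
    then have "(\<lambda>p. K / r * (\<lambda>(m, n). \<bar>a (m, n)\<bar> * r ^ m * r ^ n) (case p of (m, n) \<Rightarrow> (Suc m, n))) summable_on UNIV"
      by (rule summable_on_cmult_right)
    then have "(\<lambda>p. norm ((\<lambda>(m, n). d (m, n) * x ^ m * y ^ n) p)) summable_on UNIV"
    proof (rule Infinite_Sum.abs_summable_on_comparison_test')
      fix p :: "nat \<times> nat"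
      obtain m n where p: "p = (m, n)" by fastforce
      have "(real (Suc m) * \<bar>x\<bar> ^ m) * \<bar>y\<bar> ^ n \<le> (K * r ^ m) * r ^ n"
        by (rule mult_mono[OF K power_mono]) (use xy in \<open>auto intro: order_trans[OF _ K[of m]]\<close>)
      then have "\<bar>a (Suc m, n)\<bar> * ((real (Suc m) * \<bar>x\<bar> ^ m) * \<bar>y\<bar> ^ n)
                 \<le> \<bar>a (Suc m, n)\<bar> * ((K * r ^ m) * r ^ n)"
        by (rule mult_left_mono) auto
      then show "norm ((\<lambda>(m, n). d (m, n) * x ^ m * y ^ n) p)
        \<le> K / r * (\<lambda>(m, n). \<bar>a (m, n)\<bar> * r ^ m * r ^ n) (case p of (m, n) \<Rightarrow> (Suc m, n))"
        using r(1) by (simp add: p d_def abs_mult power_abs mult_ac)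
    qed
    then have "(\<lambda>(m, n). d (m, n) * x ^ m * y ^ n) summable_on UNIV"
      by (rule summable_on_iff_abs_summable_on_real[THEN iffD2])
    then obtain s where s: "((\<lambda>(m, n). d (m, n) * x ^ m * y ^ n) has_sum s) UNIV"
      by (auto simp: summable_on_def)
    have "(\<lambda>m. diffs b m * x ^ m) sums s"
    proof (rule has_sum_imp_sums, rule has_sum_Sigma')
      show "((\<lambda>(m, n). d (m, n) * x ^ m * y ^ n) has_sum s) (UNIV \<times> UNIV)"
        using s by simp
      show "((\<lambda>n. case (m, n) of (m, n) \<Rightarrow> d (m, n) * x ^ m * y ^ n) has_sum diffs b m * x ^ m) UNIV" for m
        using has_sum_cmult_left[OF b[of "Suc m"], of "real (Suc m) * x ^ m"]
        by (simp add: d_def diffs_def mult_ac)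
    qed
    then have "s = D" by (simp add: D_def sums_iff)
    with s deriv D show ?thesis by simp
  qed
  show "power_series2 (\<lambda>(m, n). real (Suc m) * a (Suc m, n)) (partial1 f)"
    unfolding power_series2_def eventually_nhds_0_box d_def[symmetric]
    by (rule exI[of _ "r / 2"]) (use r(1) main in auto)
  show "\<forall>\<^sub>F z in nhds 0. ((\<lambda>x. f (x, snd z)) has_real_derivative partial1 f z) (at (fst z))"
    unfolding eventually_nhds_0_box
    by (rule exI[of _ "r / 2"]) (use r(1) main in auto)
qed

lemma power_series2_tendsto:
  assumes "power_series2 a f"
  shows "(f \<longlongrightarrow> a (0, 0)) (nhds 0)"
proof (rule tendstoI)
  fix e :: real
  assume e: "e > 0"
  obtain r C where r: "r > 0" and
    C: "\<And>x y. \<bar>x\<bar> \<le> r \<Longrightarrow> \<bar>y\<bar> \<le> r \<Longrightarrow>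
       \<bar>f (x, y) - (\<Sum>(m, n) | m + n < 1. a (m, n) * x ^ m * y ^ n)\<bar> \<le> C * max \<bar>x\<bar> \<bar>y\<bar> ^ 1"
    using power_series2_remainder[OF assms] by blast
  define K where "K = \<bar>C\<bar> + 1"
  have K: "K > 0" "C \<le> K" by (auto simp: K_def)
  define s where "s = min r (e / (2 * K))"
  have s: "s > 0" "s \<le> r" "s \<le> e / (2 * K)"
    using r e K by (auto simp: s_def)
  have Ks: "K * s < e"
    using mult_left_mono[OF s(3), of K] K(1) e by simp
  have "dist (f (x, y)) (a (0, 0)) < e" if "\<bar>x\<bar> \<le> s" "\<bar>y\<bar> \<le> s" for x y
  proof -
    have "{(m, n). m + n < (1 :: nat)} = {(0, 0)}" by auto
    then have "\<bar>f (x, y) - a (0, 0)\<bar> \<le> C * max \<bar>x\<bar> \<bar>y\<bar>"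
      using C[of x y] that s(2) by simp
    also have "\<dots> \<le> K * s"
      using that K by (intro mult_mono) auto
    finally show ?thesis using Ks by (simp add: dist_real_def)
  qed
  with s(1) show "\<forall>\<^sub>F z in nhds 0. dist (f z) (a (0, 0)) < e"
    unfolding eventually_nhds_0_box by blast
qed

text \<open>Second-order Taylor polynomial along a curve into the origin.  In this form it can be combined with
  expansions that contain logarithms.\<close>

lemma power_series2_along_curve:
  fixes x y :: "real \<Rightarrow> real"
  assumes "power_series2 a f"
    and x: "x \<in> O[at_right 0](\<lambda>t. t)" and y: "y \<in> O[at_right 0](\<lambda>t. t)"
  shows "(\<lambda>t. f (x t, y t) -
           (a (0, 0) + a (1, 0) * x t + a (0, 1) * y t
             + a (2, 0) * (x t)\<^sup>2 + a (1, 1) * x t * y t + a (0, 2) * (y t)\<^sup>2))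
         \<in> O[at_right 0](\<lambda>t. t ^ 3)"
proof -
  obtain r C where r: "r > 0" and
    C: "\<And>x y. \<bar>x\<bar> \<le> r \<Longrightarrow> \<bar>y\<bar> \<le> r \<Longrightarrow>
       \<bar>f (x, y) - (\<Sum>(m, n) | m + n < 3. a (m, n) * x ^ m * y ^ n)\<bar> \<le> C * max \<bar>x\<bar> \<bar>y\<bar> ^ 3"
    using power_series2_remainder[OF assms(1)] by blast
  obtain c where c: "c > 0" "\<forall>\<^sub>F t in at_right 0. norm (x t) \<le> c * norm t"
    using landau_o.bigE[OF x] by blast
  obtain d where d: "d > 0" "\<forall>\<^sub>F t in at_right 0. norm (y t) \<le> d * norm t"
    using landau_o.bigE[OF y] by blast
  define k where "k = max c d"
  have k: "k > 0" "c \<le> k" "d \<le> k" using c(1) by (auto simp: k_def)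
  have small: "\<forall>\<^sub>F t in at_right 0. 0 < t \<and> k * t < r"
    using eventually_at_right_real[of 0 "r / k"] r k(1)
    by (auto elim!: eventually_mono simp: field_simps)
  have "{p. fst p + snd p < (3 :: nat)} = {(0,0), (1,0), (0,1), (2,0), (1,1), (0,2)}"
    by (auto simp: numeral_3_eq_3 less_Suc_eq numeral_2_eq_2)
  then have ix: "{(m, n). m + n < (3 :: nat)} = {(0,0), (1,0), (0,1), (2,0), (1,1), (0,2)}"
    by (simp add: case_prod_unfold)
  show ?thesis
  proof (rule bigoI)
    show "\<forall>\<^sub>F t in at_right 0. norm (f (x t, y t) -
           (a (0, 0) + a (1, 0) * x t + a (0, 1) * y t
             + a (2, 0) * (x t)\<^sup>2 + a (1, 1) * x t * y t + a (0, 2) * (y t)\<^sup>2))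
         \<le> (\<bar>C\<bar> * k ^ 3) * norm (t ^ 3)"
      using c(2) d(2) small
    proof eventually_elim
      case (elim t)
      have le: "\<bar>x t\<bar> \<le> k * t" "\<bar>y t\<bar> \<le> k * t"
        using elim k by (auto intro: order_trans[OF _ mult_right_mono])
      have "\<bar>f (x t, y t) - (\<Sum>(m, n) | m + n < 3. a (m, n) * x t ^ m * y t ^ n)\<bar>
            \<le> C * max \<bar>x t\<bar> \<bar>y t\<bar> ^ 3"
        using le elim by (intro C) auto
      also have "\<dots> \<le> \<bar>C\<bar> * (k * t) ^ 3"
        using le by (intro mult_mono power_mono) auto
      finally show ?case
        using elim by (simp add: ix power_mult_distrib algebra_simps)
    qed
  qed
qed

section \<open>Differentiation through a local inverse\<close>

text \<open>\<open>G\<close> is known only through \<open>G \<circ> f = w\<close>.  By invariance of domain the values of \<open>f\<close> fill a neighbourhood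
  of \<open>f x\<close>, so \<open>G = w \<circ> inv f\<close> there.\<close>

lemma DERIV_factor_through_inverse:
  fixes f w G :: "real \<Rightarrow> real"
  assumes S: "open S" "x \<in> S" "inj_on f S"
    and f: "\<And>u. u \<in> S \<Longrightarrow> (f has_real_derivative f' u) (at u)" and "f' x \<noteq> 0"
    and w: "(w has_real_derivative w') (at x)"
    and G: "\<And>u. u \<in> S \<Longrightarrow> G (f u) = w u"
  shows "(G has_real_derivative w' / f' x) (at (f x))"
proof -
  define g where "g = inv_into S f"
  have cont: "continuous_on S f"
    using f by (meson DERIV_isCont continuous_at_imp_continuous_on)
  have gf: "g (f u) = u" if "u \<in> S" for u
    using that S(3) by (simp add: g_def)
  have "(g has_derivative (*) (inverse (f' x))) (at (f x))"
  proof (rule has_derivative_inverse_strong[OF S(1,2) cont gf])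
    show "(f has_derivative (*) (f' x)) (at x)"
      using f[OF S(2)] by (simp add: has_field_derivative_def)
    show "(*) (f' x) \<circ> (*) (inverse (f' x)) = id"
      using \<open>f' x \<noteq> 0\<close> by (auto simp: fun_eq_iff)
  qed
  then have "(g has_real_derivative inverse (f' x)) (at (f x))"
    by (simp add: has_field_derivative_def)
  then have "((\<lambda>v. w (g v)) has_real_derivative w' * inverse (f' x)) (at (f x))"
    by (rule DERIV_chain2[rotated]) (simp add: gf S(2) w)
  then have "((\<lambda>v. w (g v)) has_real_derivative w' / f' x) (at (f x))"
    by (simp add: divide_inverse)
  then show ?thesis
  proof (rule has_field_derivative_transform_within_open)
    show "open (f ` S)"
      by (rule invariance_of_domain[OF cont S(1,3)])
  qed (use S(2) in \<open>auto simp: gf G\<close>)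
qed

section \<open>The singular part of the action\<close>

definition singular_action :: "real \<Rightarrow> real \<Rightarrow> real" where
  "singular_action y x = y * Arg (Complex x y) - x * ln (norm (Complex x y)) + x"

lemma DERIV_Arg_Complex:
  assumes "y \<noteq> 0"
  shows "((\<lambda>x. Arg (Complex x y)) has_real_derivative - y / (x\<^sup>2 + y\<^sup>2)) (at x)"
proof -
  have "Complex x y \<notin> \<real>\<^sub>\<le>\<^sub>0"
    using assms by (auto simp: complex_nonpos_Reals_iff)
  then have "(Ln has_field_derivative inverse (Complex x y)) (at (Complex x y))"
    by (rule has_field_derivative_Ln)
  moreover have "((\<lambda>x. Complex x y) has_vector_derivative 1) (at x)"
    by (auto simp: has_vector_derivative_complex_iff intro!: derivative_eq_intros)
  ultimately have "((Ln \<circ> (\<lambda>x. Complex x y)) has_vector_derivative 1 * inverse (Complex x y)) (at x)"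
    by (intro field_vector_diff_chain_at)
  then have "((\<lambda>x. Im ((Ln \<circ> (\<lambda>x. Complex x y)) x)) has_real_derivative
               Im (1 * inverse (Complex x y))) (at x)"
    by (rule has_field_derivative_Im)
  moreover have "Im ((Ln \<circ> (\<lambda>x. Complex x y)) x) = Arg (Complex x y)" for x
    using assms by (subst Arg_eq_Im_Ln) (auto simp: complex_eq_iff)
  ultimately show ?thesis by simp
qed

lemma ln_norm_Complex:
  assumes "(x, y) \<noteq> (0, 0)"
  shows "ln (norm (Complex x y)) = ln (x\<^sup>2 + y\<^sup>2) / 2"
proof -
  have "x\<^sup>2 + y\<^sup>2 > 0" using assms by (simp add: sum_power2_gt_zero_iff)
  then show ?thesis by (simp add: complex_norm ln_sqrt)
qed

text \<open>The contributions \<open>- y\<^sup>2 / (x\<^sup>2 + y\<^sup>2)\<close> of the argument and \<open>- x\<^sup>2 / (x\<^sup>2 + y\<^sup>2)\<close> of the logarithm add up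
  to \<open>-1\<close> and cancel the derivative of the last summand.  The formula also holds on the negative real
  axis, where \<^const>\<open>Arg\<close> jumps: the jump is in the direction of \<open>y\<close>, and on the axis the factor \<open>y\<close>
  removes the argument.\<close>

lemma DERIV_singular_action:
  assumes "(x, y) \<noteq> (0, 0)"
  shows "(singular_action y has_real_derivative - ln (norm (Complex x y))) (at x)"
proof -
  have pos: "x\<^sup>2 + y\<^sup>2 > 0" using assms by (simp add: sum_power2_gt_zero_iff)
  have A: "((\<lambda>x. y * Arg (Complex x y)) has_real_derivative - y\<^sup>2 / (x\<^sup>2 + y\<^sup>2)) (at x)"
    using DERIV_cmult[OF DERIV_Arg_Complex[of y x], of y]
    by (cases "y = 0") (simp_all add: power2_eq_square)
  have L: "((\<lambda>x. - x * (ln (x\<^sup>2 + y\<^sup>2) / 2) + x) has_real_derivative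
               - ln (x\<^sup>2 + y\<^sup>2) / 2 - x\<^sup>2 / (x\<^sup>2 + y\<^sup>2) + 1) (at x)"
    using pos by (auto intro!: derivative_eq_intros simp: power2_eq_square field_simps)
  have "((\<lambda>x. y * Arg (Complex x y) + (- x * (ln (x\<^sup>2 + y\<^sup>2) / 2) + x)) has_real_derivative
          - y\<^sup>2 / (x\<^sup>2 + y\<^sup>2) + (- ln (x\<^sup>2 + y\<^sup>2) / 2 - x\<^sup>2 / (x\<^sup>2 + y\<^sup>2) + 1)) (at x)"
    by (rule DERIV_add[OF A L])
  moreover have "- y\<^sup>2 / (x\<^sup>2 + y\<^sup>2) + (- ln (x\<^sup>2 + y\<^sup>2) / 2 - x\<^sup>2 / (x\<^sup>2 + y\<^sup>2) + 1)
                 = - ln (norm (Complex x y))"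
  proof -
    have "y\<^sup>2 / (x\<^sup>2 + y\<^sup>2) + x\<^sup>2 / (x\<^sup>2 + y\<^sup>2) = 1"
      using pos by (metis add.commute add_divide_distrib divide_self less_irrefl)
    then show ?thesis by (simp add: ln_norm_Complex[OF assms])
  qed
  moreover have "(\<lambda>x. y * Arg (Complex x y) + (- x * (ln (x\<^sup>2 + y\<^sup>2) / 2) + x)) = singular_action y"
  proof
    fix x
    show "y * Arg (Complex x y) + (- x * (ln (x\<^sup>2 + y\<^sup>2) / 2) + x) = singular_action y x"
      by (cases "(x, y) = (0, 0)") (auto simp: singular_action_def ln_norm_Complex)
  qed
  ultimately show ?thesis by simp
qed

lemma mvt_between:
  fixes f :: "real \<Rightarrow> real"
  assumes "\<And>u. u \<in> closed_segment a b \<Longrightarrow> (f has_real_derivative f' u) (at u)"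
  obtains \<xi> where "\<xi> \<in> closed_segment a b" "f b - f a = (b - a) * f' \<xi>"
proof (cases a b rule: linorder_cases)
  case less
  then obtain z where "a < z" "z < b" "f b - f a = (b - a) * f' z"
    using MVT2[of a b f f'] assms by (auto simp: closed_segment_eq_real_ivl)
  then show ?thesis using that[of z] less by (auto simp: closed_segment_eq_real_ivl)
next
  case equal
  then show ?thesis using that[of a] by simp
next
  case greater
  then obtain z where "b < z" "z < a" "f a - f b = (a - b) * f' z"
    using MVT2[of b a f f'] assms by (auto simp: closed_segment_eq_real_ivl)
  then show ?thesis using that[of z] greater by (auto simp: closed_segment_eq_real_ivl algebra_simps)
qed

lemma near_identity_curve:
  fixes u :: "real \<Rightarrow> real"
  assumes u: "(\<lambda>t. u t - t - \<gamma> * t\<^sup>2) \<in> O[at_right 0](\<lambda>t. t ^ 3)"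
  shows "(\<lambda>t. u t - t) \<in> O[at_right 0](\<lambda>t. t\<^sup>2)"
    and "u \<in> O[at_right 0](\<lambda>t. t)"
    and "((\<lambda>t. u t / t) \<longlongrightarrow> 1) (at_right 0)"
    and "(u \<longlongrightarrow> 0) (at_right 0)"
proof -
  have pos: "\<forall>\<^sub>F t::real in at_right 0. t > 0" by (rule eventually_at_right_less)
  have cubic_small: "(\<lambda>t::real. t ^ 3) \<in> o[at_right 0](\<lambda>t. t\<^sup>2)" by real_asymp
  have "(\<lambda>t. (u t - t - \<gamma> * t\<^sup>2) + \<gamma> * t\<^sup>2) \<in> O[at_right 0](\<lambda>t. t\<^sup>2)"
    by (intro sum_in_bigo landau_o.big_trans[OF u] landau_o.small_imp_big[OF cubic_small]) simp
  then show u2: "(\<lambda>t. u t - t) \<in> O[at_right 0](\<lambda>t. t\<^sup>2)" by simp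
  have sq_small: "(\<lambda>t::real. t\<^sup>2) \<in> o[at_right 0](\<lambda>t. t)" by real_asymp
  have u1: "(\<lambda>t. u t - t) \<in> o[at_right 0](\<lambda>t. t)"
    by (rule landau_o.big_small_trans[OF u2 sq_small])
  have "((\<lambda>t. (u t - t) / t + 1) \<longlongrightarrow> 0 + 1) (at_right 0)"
    by (intro tendsto_add smalloD_tendsto[OF u1] tendsto_const)
  then have "((\<lambda>t. (u t - t) / t + 1) \<longlongrightarrow> 1) (at_right 0)" by simp
  then show ratio: "((\<lambda>t. u t / t) \<longlongrightarrow> 1) (at_right 0)"
    by (rule Lim_transform_eventually) (use pos in \<open>eventually_elim, simp add: field_simps\<close>)
  show "u \<in> O[at_right 0](\<lambda>t. t)"
    by (rule bigoI_tendsto[OF ratio]) (auto simp: eventually_at_filter)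
  have "((\<lambda>t. u t / t * t) \<longlongrightarrow> 1 * 0) (at_right 0)"
    by (intro tendsto_mult ratio tendsto_ident_at)
  then have "((\<lambda>t. u t / t * t) \<longlongrightarrow> 0) (at_right 0)" by simp
  then show "(u \<longlongrightarrow> 0) (at_right 0)"
    by (rule Lim_transform_eventually) (use pos in \<open>eventually_elim, simp\<close>)
qed

text \<open>By the mean value theorem the increment is \<open>- (u t - t) ln \<bar>(\<xi>, \<kappa> t)\<bar>\<close> with \<open>\<xi>\<close> between \<open>t\<close> and \<open>u t\<close>.
  Since \<open>\<xi> / t \<rightarrow> 1\<close>, the logarithm is \<open>ln t + ln (1 + \<kappa>\<^sup>2) / 2 + o(1)\<close>, while \<open>u t - t\<close> is
  \<open>\<gamma> t\<^sup>2 + O(t\<^sup>3)\<close>.\<close>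

lemma singular_action_increment:
  fixes u :: "real \<Rightarrow> real"
  assumes u: "(\<lambda>t. u t - t - \<gamma> * t\<^sup>2) \<in> O[at_right 0](\<lambda>t. t ^ 3)"
  shows "(\<lambda>t. singular_action (\<kappa> * t) (u t) - singular_action (\<kappa> * t) t
            + \<gamma> * t\<^sup>2 * ln t + \<gamma> * ln (1 + \<kappa>\<^sup>2) / 2 * t\<^sup>2) \<in> o[at_right 0](\<lambda>t. t\<^sup>2)"
proof -
  define \<delta> where "\<delta> t = u t - t" for t
  have \<delta>\<gamma>: "(\<lambda>t. \<delta> t - \<gamma> * t\<^sup>2) \<in> O[at_right 0](\<lambda>t. t ^ 3)"
    using u by (simp add: \<delta>_def)
  have \<delta>: "\<delta> \<in> O[at_right 0](\<lambda>t. t\<^sup>2)"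
    using near_identity_curve(1)[OF u] by (simp add: \<delta>_def[abs_def])
  have "(\<lambda>t::real. t\<^sup>2) \<in> o[at_right 0](\<lambda>t. t)" by real_asymp
  with \<delta> have "\<delta> \<in> o[at_right 0](\<lambda>t. t)" by (rule landau_o.big_small_trans)
  then have \<delta>0: "((\<lambda>t. \<delta> t / t) \<longlongrightarrow> 0) (at_right 0)"
    by (rule smalloD_tendsto)
  have "\<exists>\<xi>. 0 < t \<and> \<bar>\<delta> t / t\<bar> < 1 / 2 \<longrightarrow> \<bar>\<xi> - t\<bar> \<le> \<bar>\<delta> t\<bar> \<and>
          singular_action (\<kappa> * t) (u t) - singular_action (\<kappa> * t) t
            = \<delta> t * - ln (norm (Complex \<xi> (\<kappa> * t)))" for t
  proof (cases "0 < t \<and> \<bar>\<delta> t / t\<bar> < 1 / 2")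
    case True
    then have *: "0 < t" "\<bar>u t - t\<bar> < t / 2" by (auto simp: \<delta>_def field_simps)
    have "v > 0" if "v \<in> closed_segment t (u t)" for v
      using that * by (auto simp: closed_segment_eq_real_ivl split: if_splits)
    then have "(singular_action (\<kappa> * t) has_real_derivative - ln (norm (Complex v (\<kappa> * t)))) (at v)"
      if "v \<in> closed_segment t (u t)" for v
      using that by (intro DERIV_singular_action) force
    then obtain \<xi> where \<xi>: "\<xi> \<in> closed_segment t (u t)"
      "singular_action (\<kappa> * t) (u t) - singular_action (\<kappa> * t) t
            = (u t - t) * - ln (norm (Complex \<xi> (\<kappa> * t)))"
      by (rule mvt_between)
    then have "\<bar>\<xi> - t\<bar> \<le> \<bar>\<delta> t\<bar>"
      by (auto simp: \<delta>_def closed_segment_eq_real_ivl split: if_splits)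
    with \<xi>(2) show ?thesis by (auto simp: \<delta>_def)
  qed auto
  then obtain \<xi> where \<xi>: "\<And>t. 0 < t \<Longrightarrow> \<bar>\<delta> t / t\<bar> < 1 / 2 \<Longrightarrow> \<bar>\<xi> t - t\<bar> \<le> \<bar>\<delta> t\<bar> \<and>
          singular_action (\<kappa> * t) (u t) - singular_action (\<kappa> * t) t
            = \<delta> t * - ln (norm (Complex (\<xi> t) (\<kappa> * t)))"
    by metis
  have pos: "\<forall>\<^sub>F t :: real in at_right 0. 0 < t"
    by (simp add: eventually_at_right_less)
  have half: "\<forall>\<^sub>F t in at_right 0. \<bar>\<delta> t / t\<bar> < 1 / 2"
    using tendstoD[OF \<delta>0, of "1 / 2"] by (simp add: dist_real_def)
  have "((\<lambda>t. \<xi> t / t - 1) \<longlongrightarrow> 0) (at_right 0)"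
  proof (rule Lim_null_comparison)
    show "\<forall>\<^sub>F t in at_right 0. norm (\<xi> t / t - 1) \<le> \<bar>\<delta> t / t\<bar>"
      using pos half
    proof eventually_elim
      case (elim t)
      have "\<xi> t / t - 1 = (\<xi> t - t) / t" using elim by (simp add: field_simps)
      with \<xi>[of t] elim show ?case by (simp add: divide_right_mono)
    qed
    show "((\<lambda>t. \<bar>\<delta> t / t\<bar>) \<longlongrightarrow> 0) (at_right 0)"
      using tendsto_rabs_zero[OF \<delta>0] .
  qed
  then have \<xi>t: "((\<lambda>t. \<xi> t / t) \<longlongrightarrow> 1) (at_right 0)"
    by (simp add: LIM_zero_iff)
  define \<mu> where "\<mu> t = ln ((\<xi> t / t)\<^sup>2 + \<kappa>\<^sup>2) / 2" for t
  have one: "1 + \<kappa>\<^sup>2 > 0" by (simp add: add_pos_nonneg)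
  have "(\<mu> \<longlongrightarrow> ln (1\<^sup>2 + \<kappa>\<^sup>2) / 2) (at_right 0)"
    unfolding \<mu>_def using one by (intro tendsto_intros \<xi>t) auto
  then have \<mu>: "(\<mu> \<longlongrightarrow> ln (1 + \<kappa>\<^sup>2) / 2) (at_right 0)" by simp
  have \<mu>1: "\<mu> \<in> O[at_right 0](\<lambda>_. 1)"
    by (rule bigoI_tendsto[OF _ ]) (use \<mu> in auto)
  have \<mu>0: "(\<lambda>t. \<mu> t - ln (1 + \<kappa>\<^sup>2) / 2) \<in> o[at_right 0](\<lambda>_. 1)"
    by (rule smalloI_tendsto) (use \<mu> in \<open>auto simp: LIM_zero_iff\<close>)
  have "(\<lambda>t. - ((\<delta> t - \<gamma> * t\<^sup>2) * ln t) - (\<delta> t - \<gamma> * t\<^sup>2) * \<mu> t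
              - \<gamma> * (t\<^sup>2 * (\<mu> t - ln (1 + \<kappa>\<^sup>2) / 2))) \<in> o[at_right 0](\<lambda>t. t\<^sup>2)"
  proof (intro sum_in_smallo)
    have "(\<lambda>t. (\<delta> t - \<gamma> * t\<^sup>2) * ln t) \<in> O[at_right 0](\<lambda>t. t ^ 3 * ln t)"
      by (rule landau_o.big.mult[OF \<delta>\<gamma>]) simp
    also have "(\<lambda>t :: real. t ^ 3 * ln t) \<in> o[at_right 0](\<lambda>t. t\<^sup>2)" by real_asymp
    finally show "(\<lambda>t. - ((\<delta> t - \<gamma> * t\<^sup>2) * ln t)) \<in> o[at_right 0](\<lambda>t. t\<^sup>2)"
      by (simp only: landau_o.small.uminus_in_iff)
    have "(\<lambda>t. (\<delta> t - \<gamma> * t\<^sup>2) * \<mu> t) \<in> O[at_right 0](\<lambda>t. t ^ 3 * 1)"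
      by (rule landau_o.big.mult[OF \<delta>\<gamma> \<mu>1])
    also have "(\<lambda>t :: real. t ^ 3 * 1) \<in> o[at_right 0](\<lambda>t. t\<^sup>2)" by real_asymp
    finally show "(\<lambda>t. (\<delta> t - \<gamma> * t\<^sup>2) * \<mu> t) \<in> o[at_right 0](\<lambda>t. t\<^sup>2)" .
    have "(\<lambda>t. t\<^sup>2 * (\<mu> t - ln (1 + \<kappa>\<^sup>2) / 2)) \<in> o[at_right 0](\<lambda>t. t\<^sup>2 * 1)"
      by (rule landau_o.big_small_mult[OF _ \<mu>0]) simp
    then show "(\<lambda>t. \<gamma> * (t\<^sup>2 * (\<mu> t - ln (1 + \<kappa>\<^sup>2) / 2))) \<in> o[at_right 0](\<lambda>t. t\<^sup>2)"
      by simp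
  qed
  then show ?thesis
  proof (rule landau_o.small.in_cong[THEN iffD1, rotated])
    show "\<forall>\<^sub>F t in at_right 0. - ((\<delta> t - \<gamma> * t\<^sup>2) * ln t) - (\<delta> t - \<gamma> * t\<^sup>2) * \<mu> t
              - \<gamma> * (t\<^sup>2 * (\<mu> t - ln (1 + \<kappa>\<^sup>2) / 2))
            = singular_action (\<kappa> * t) (u t) - singular_action (\<kappa> * t) t
            + \<gamma> * t\<^sup>2 * ln t + \<gamma> * ln (1 + \<kappa>\<^sup>2) / 2 * t\<^sup>2"
      using pos half
    proof eventually_elim
      case (elim t)
      have "\<xi> t \<noteq> 0" using \<xi>[of t] elim by (auto simp: field_simps)
      then have p: "(\<xi> t / t)\<^sup>2 + \<kappa>\<^sup>2 > 0" using elim by (simp add: sum_power2_gt_zero_iff)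
      have "ln (norm (Complex (\<xi> t) (\<kappa> * t))) = ln ((\<xi> t)\<^sup>2 + (\<kappa> * t)\<^sup>2) / 2"
        using \<open>\<xi> t \<noteq> 0\<close> by (intro ln_norm_Complex) simp
      also have "(\<xi> t)\<^sup>2 + (\<kappa> * t)\<^sup>2 = t\<^sup>2 * ((\<xi> t / t)\<^sup>2 + \<kappa>\<^sup>2)"
        using elim by (simp add: field_simps)
      also have "ln \<dots> = ln (t\<^sup>2) + ln ((\<xi> t / t)\<^sup>2 + \<kappa>\<^sup>2)"
        using elim p by (intro ln_mult_pos) auto
      also have "\<dots> / 2 = ln t + \<mu> t"
        using elim by (simp add: ln_realpow \<mu>_def)
      finally show ?case
        using \<xi>[of t] elim by (simp add: algebra_simps)
    qed
  qed
qed

lemma singular_action_minus: "singular_action (- y) x = singular_action y x"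
proof (cases "y = 0")
  case False
  then have "Complex x y \<notin> \<real>" by (simp add: complex_is_Real_iff)
  moreover have "Complex x (- y) = cnj (Complex x y)" by (simp add: complex_eq_iff)
  ultimately show ?thesis
    by (simp only: singular_action_def Arg_cnj complex_mod_cnj if_False)
qed simp

section \<open>A complete elliptic integral near its logarithmic singularity\<close>

text \<open>In terms of the complete elliptic integrals, \<open>ell0 m = sqrt (1 + m) E(1 / (1 + m))\<close> and
  \<open>2 ell1 m = K(1 / (1 + m)) / sqrt (1 + m)\<close> with parameter \<open>k\<^sup>2 = 1 / (1 + m)\<close>, so \<open>m = 0\<close> is the logarithmic
  singularity \<open>k = 1\<close>.  The functions \<open>ell1\<close> and \<open>ell2\<close> are the first two derivatives of \<open>ell0\<close>.\<close>

definition ell0 :: "real \<Rightarrow> real" where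
  "ell0 m = integral {0..pi/2} (\<lambda>u. sqrt (m + (sin u)\<^sup>2))"

definition ell1 :: "real \<Rightarrow> real" where
  "ell1 m = integral {0..pi/2} (\<lambda>u. 1 / (2 * sqrt (m + (sin u)\<^sup>2)))"

definition ell2 :: "real \<Rightarrow> real" where
  "ell2 m = integral {0..pi/2} (\<lambda>u. - 1 / (4 * sqrt (m + (sin u)\<^sup>2) ^ 3))"

lemma pos_add_sin_sq: "m > 0 \<Longrightarrow> m + (sin u)\<^sup>2 > (0 :: real)"
  by (simp add: add_pos_nonneg)

lemma add_sin_sq_nonzero: "m > 0 \<Longrightarrow> m + (sin u)\<^sup>2 \<noteq> (0 :: real)"
  using pos_add_sin_sq[of m u] by simp

lemma DERIV_integral_param:
  fixes f :: "real \<Rightarrow> real \<Rightarrow> real"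
  assumes "\<And>m u. m > 0 \<Longrightarrow> ((\<lambda>m. f m u) has_real_derivative f' m u) (at m)"
    and "continuous_on ({0<..} \<times> {a..b}) (\<lambda>(m, u). f m u)"
    and "continuous_on ({0<..} \<times> {a..b}) (\<lambda>(m, u). f' m u)"
    and "m > 0"
  shows "((\<lambda>m. integral {a..b} (f m)) has_real_derivative integral {a..b} (f' m)) (at m)"
proof -
  have "((\<lambda>m. integral (cbox a b) (f m)) has_real_derivative integral (cbox a b) (f' m))
          (at m within {0<..})"
  proof (rule leibniz_rule_field_derivative)
    fix m t :: real
    assume "m \<in> {0<..}"
    then show "((\<lambda>m. f m t) has_real_derivative f' m t) (at m within {0<..})"
      using assms(1) by (auto intro: has_field_derivative_at_within)
  next
    fix m :: real
    assume m: "m \<in> {0<..}"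
    have "continuous_on (cbox a b) (\<lambda>u. (\<lambda>(m, u). f m u) (m, u))"
      by (rule continuous_on_compose2[OF assms(2)]) (use m in \<open>auto intro!: continuous_intros\<close>)
    then show "f m integrable_on cbox a b"
      by (intro integrable_continuous) simp
  qed (use assms in auto)
  then show ?thesis
    using assms(4) by (simp add: at_within_open[of _ "{0<..}"])
qed

lemma DERIV_ell0: "m > 0 \<Longrightarrow> (ell0 has_real_derivative ell1 m) (at m)"
  unfolding ell0_def[abs_def] ell1_def
proof (rule DERIV_integral_param)
  show "((\<lambda>m. sqrt (m + (sin u)\<^sup>2)) has_real_derivative 1 / (2 * sqrt (m + (sin u)\<^sup>2))) (at m)"
    if "m > 0" for m u
    using pos_add_sin_sq[OF that, of u]
    by (auto intro!: derivative_eq_intros simp: field_simps)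
  show "continuous_on ({0<..} \<times> {0..pi / 2}) (\<lambda>(m, u). 1 / (2 * sqrt (m + (sin u)\<^sup>2)))"
    unfolding case_prod_unfold
    by (intro continuous_intros) (auto simp: add_sin_sq_nonzero)
qed (auto simp: case_prod_unfold intro!: continuous_intros)

lemma DERIV_ell1: "m > 0 \<Longrightarrow> (ell1 has_real_derivative ell2 m) (at m)"
  unfolding ell1_def[abs_def] ell2_def
proof (rule DERIV_integral_param)
  show "((\<lambda>m. 1 / (2 * sqrt (m + (sin u)\<^sup>2))) has_real_derivative
           - 1 / (4 * sqrt (m + (sin u)\<^sup>2) ^ 3)) (at m)" if "m > 0" for m u
    using pos_add_sin_sq[OF that, of u]
    by (auto intro!: derivative_eq_intros simp: field_simps power3_eq_cube)
  show "continuous_on ({0<..} \<times> {0..pi / 2}) (\<lambda>(m, u). 1 / (2 * sqrt (m + (sin u)\<^sup>2)))"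
       "continuous_on ({0<..} \<times> {0..pi / 2}) (\<lambda>(m, u). - 1 / (4 * sqrt (m + (sin u)\<^sup>2) ^ 3))"
    unfolding case_prod_unfold
    by (intro continuous_intros; auto simp: add_sin_sq_nonzero)+
qed

text \<open>With \<open>R = sqrt (m + sin\<^sup>2 u)\<close>, the integrand \<open>- m (1 + m) / (4 R\<^sup>3) + R / 4\<close> is the derivative of
  \<open>- sin u cos u / (4 R)\<close>, which vanishes at both ends of the interval.\<close>

lemma ell_ode:
  assumes m: "m > 0"
  shows "m * (1 + m) * ell2 m + ell0 m / 4 = 0"
proof -
  define R where "R u = sqrt (m + (sin u)\<^sup>2)" for u
  have R: "R u > 0" "(R u)\<^sup>2 = m + (sin u)\<^sup>2" for u
    using pos_add_sin_sq[OF m, of u] by (auto simp: R_def)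
  have dR: "(R has_real_derivative sin u * cos u / R u) (at u within A)" for u A
    unfolding R_def using pos_add_sin_sq[OF m, of u]
    by (auto intro!: derivative_eq_intros simp: field_simps)
  have "((\<lambda>u. - 1 / 4 * (sin u * cos u / R u)) has_vector_derivative
          m * (1 + m) * (- 1 / (4 * R u ^ 3)) + R u / 4) (at u within {0..pi/2})" for u
  proof -
    have "((\<lambda>u. sin u * cos u / R u) has_real_derivative
            ((cos u * cos u - sin u * sin u) * R u - sin u * cos u * (sin u * cos u / R u))
                / (R u * R u)) (at u within {0..pi/2})"
      by (rule derivative_eq_intros dR refl)+ (use R(1)[of u] in \<open>auto simp: algebra_simps\<close>)
    then have "((\<lambda>u. - 1 / 4 * (sin u * cos u / R u)) has_real_derivative
            - 1 / 4 * (((cos u * cos u - sin u * sin u) * R u - sin u * cos u * (sin u * cos u / R u))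
                / (R u * R u))) (at u within {0..pi/2})"
      by (rule DERIV_cmult)
    moreover have "- 1 / 4 * (((cos u * cos u - sin u * sin u) * R u - sin u * cos u * (sin u * cos u / R u))
                / (R u * R u)) = m * (1 + m) * (- 1 / (4 * R u ^ 3)) + R u / 4"
    proof -
      define r s where "r = R u" and "s = sin u"
      have c: "cos u * cos u = 1 - s\<^sup>2"
        using sin_cos_squared_add[of u] by (simp add: s_def power2_eq_square)
      have r: "r > 0" "m = r\<^sup>2 - s\<^sup>2" using R[of u] by (auto simp: r_def s_def)
      have "- 1 / 4 * (((cos u * cos u - s * s) * r - s * cos u * (s * cos u / r)) / (r * r))
            = - (((cos u * cos u - s * s) * r\<^sup>2 - s\<^sup>2 * (cos u * cos u))) / (4 * r ^ 3)"
        using r(1) by (simp add: field_simps power2_eq_square power3_eq_cube)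
      also have "\<dots> = (r ^ 4 - m * (1 + m)) / (4 * r ^ 3)"
        unfolding c r(2) by (simp add: field_simps power2_eq_square power4_eq_xxxx)
      also have "\<dots> = m * (1 + m) * (- 1 / (4 * r ^ 3)) + r / 4"
        using r(1) by (simp add: field_simps power3_eq_cube power4_eq_xxxx)
      finally show ?thesis by (simp only: r_def s_def)
    qed
    ultimately show ?thesis
      by (simp add: has_real_derivative_iff_has_vector_derivative)
  qed
  then have "((\<lambda>u. m * (1 + m) * (- 1 / (4 * R u ^ 3)) + R u / 4) has_integral
          - 1 / 4 * (sin (pi/2) * cos (pi/2) / R (pi/2)) - - 1 / 4 * (sin 0 * cos 0 / R 0)) {0..pi/2}"
    by (intro fundamental_theorem_of_calculus) auto
  then have I: "((\<lambda>u. m * (1 + m) * (- 1 / (4 * R u ^ 3)) + R u / 4) has_integral 0) {0..pi/2}"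
    by simp
  have cont: "continuous_on {0..pi/2} R"
    unfolding R_def by (intro continuous_intros)
  have "(R has_integral ell0 m) {0..pi/2}"
    unfolding ell0_def R_def[symmetric] by (intro integrable_integral integrable_continuous_real cont)
  then have 1: "((\<lambda>u. R u / 4) has_integral ell0 m / 4) {0..pi/2}"
    by (rule has_integral_divide)
  have "((\<lambda>u. - 1 / (4 * R u ^ 3)) has_integral ell2 m) {0..pi/2}"
    unfolding ell2_def R_def[symmetric]
    by (intro integrable_integral integrable_continuous_real continuous_intros cont)
       (use R(1) in \<open>auto simp: less_imp_neq[THEN not_sym]\<close>)
  then have "((\<lambda>u. m * (1 + m) * (- 1 / (4 * R u ^ 3))) has_integral m * (1 + m) * ell2 m) {0..pi/2}"
    by (rule has_integral_mult_right)
  from has_integral_unique[OF has_integral_add[OF this 1] I] show ?thesis .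
qed

lemma ell0_tendsto: "(ell0 \<longlongrightarrow> 1) (at_right 0)"
proof -
  have "continuous_on ({0..} \<times> cbox 0 (pi/2)) (\<lambda>(m, u). sqrt (m + (sin u)\<^sup>2))"
    unfolding case_prod_unfold by (intro continuous_intros)
  then have "continuous_on {0..} (\<lambda>m. integral (cbox 0 (pi/2)) (\<lambda>u. sqrt (m + (sin u)\<^sup>2)))"
    by (rule integral_continuous_on_param)
  then have "continuous_on {0..} ell0"
    by (simp add: ell0_def[abs_def])
  then have "(ell0 \<longlongrightarrow> ell0 0) (at 0 within {0..})"
    by (simp add: continuous_on_def)
  then have "(ell0 \<longlongrightarrow> ell0 0) (at_right 0)"
    by (rule tendsto_within_subset) auto
  moreover have "ell0 0 = 1"
  proof -
    have "((\<lambda>u. - cos u) has_vector_derivative sin u) (at u within {0..pi/2})" for u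
      unfolding has_real_derivative_iff_has_vector_derivative[symmetric]
      by (auto intro!: derivative_eq_intros)
    then have "(sin has_integral (- cos (pi/2) - - cos 0)) {0..pi/2}"
      by (intro fundamental_theorem_of_calculus) auto
    then have "(sin has_integral 1) {0..pi/2}" by simp
    then have "((\<lambda>u. sqrt (0 + (sin u)\<^sup>2)) has_integral 1) {0..pi/2}"
      by (rule has_integral_eq[rotated]) (simp add: sin_ge_zero)
    then show ?thesis unfolding ell0_def by (rule integral_unique)
  qed
  ultimately show ?thesis by simp
qed

text \<open>Split \<open>1 = cos u + (1 - cos u)\<close> in the numerator.  The first part has the primitive \<open>ln (sin u + R)\<close> and
  carries the logarithm of \<open>m\<close>; the second part stays bounded and tends to the integral of
  \<open>(1 - cos u) / sin u = sin u / (1 + cos u)\<close>, which is \<open>ln 2\<close>.\<close>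

lemma ell1_tendsto: "((\<lambda>m. ell1 m + ln m / 4) \<longlongrightarrow> ln 2) (at_right 0)"
proof -
  define G where "G m = integral {0..pi/2} (\<lambda>u. (1 - cos u) / sqrt (m + (sin u)\<^sup>2))" for m
  have split: "ell1 m + ln m / 4 = (ln (1 + sqrt (1 + m)) + G m) / 2"
    and near: "\<bar>G m - ln 2\<bar> \<le> sqrt m * (pi / 2)" if m: "m > 0" for m
  proof -
    define R where "R u = sqrt (m + (sin u)\<^sup>2)" for u
    have R: "R u > 0" "(R u)\<^sup>2 = m + (sin u)\<^sup>2" for u
      using pos_add_sin_sq[OF m, of u] by (auto simp: R_def)
    have dR: "(R has_real_derivative sin u * cos u / R u) (at u within A)" for u A
      unfolding R_def using pos_add_sin_sq[OF m, of u]
      by (auto intro!: derivative_eq_intros simp: field_simps)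
    have cont: "continuous_on {0..pi/2} R"
      unfolding R_def by (intro continuous_intros)
    have G: "((\<lambda>u. (1 - cos u) / R u) has_integral G m) {0..pi/2}"
      unfolding G_def R_def[symmetric]
      by (intro integrable_integral integrable_continuous_real continuous_intros cont)
         (use R(1) in \<open>auto simp: less_imp_neq[THEN not_sym]\<close>)
    have "((\<lambda>u. ln (sin u + R u)) has_vector_derivative cos u / R u) (at u within {0..pi/2})"
      if u: "u \<in> {0..pi/2}" for u
    proof -
      have s: "sin u \<ge> 0" using u by (intro sin_ge_zero) auto
      then have p: "sin u + R u > 0" using R(1)[of u] by simp
      have "((\<lambda>u. ln (sin u + R u)) has_real_derivative
              1 / (sin u + R u) * (cos u + sin u * cos u / R u)) (at u within {0..pi/2})"
        using p by (auto intro!: derivative_eq_intros dR)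
      moreover have "cos u + sin u * cos u / R u = (sin u + R u) * (cos u / R u)"
        using R(1)[of u] by (simp add: field_simps)
      then have "1 / (sin u + R u) * (cos u + sin u * cos u / R u) = cos u / R u"
        using p by simp
      ultimately show ?thesis
        by (simp add: has_real_derivative_iff_has_vector_derivative)
    qed
    then have "((\<lambda>u. cos u / R u) has_integral ln (sin (pi/2) + R (pi/2)) - ln (sin 0 + R 0)) {0..pi/2}"
      by (intro fundamental_theorem_of_calculus) auto
    then have "((\<lambda>u. cos u / R u) has_integral ln (1 + sqrt (1 + m)) - ln m / 2) {0..pi/2}"
      using m by (simp add: R_def ln_sqrt add.commute)
    from has_integral_divide[OF has_integral_add[OF this G], of 2]
    have "((\<lambda>u. 1 / (2 * R u)) has_integral (ln (1 + sqrt (1 + m)) - ln m / 2 + G m) / 2) {0..pi/2}"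
      by (simp add: add_divide_distrib[symmetric] mult.commute)
    then have "ell1 m = (ln (1 + sqrt (1 + m)) - ln m / 2 + G m) / 2"
      unfolding ell1_def R_def[symmetric] by (rule integral_unique)
    then show "ell1 m + ln m / 4 = (ln (1 + sqrt (1 + m)) + G m) / 2"
      by (simp add: field_simps)
    have c: "1 + cos u > 0" if "u \<in> {0..pi/2}" for u :: real
      using cos_ge_zero[of u] that by auto
    have "((\<lambda>u. - ln (1 + cos u)) has_vector_derivative sin u / (1 + cos u)) (at u within {0..pi/2})"
      if "u \<in> {0..pi/2}" for u
      unfolding has_real_derivative_iff_has_vector_derivative[symmetric]
      using c[OF that] by (auto intro!: derivative_eq_intros)
    then have "((\<lambda>u. sin u / (1 + cos u)) has_integral - ln (1 + cos (pi/2)) - - ln (1 + cos 0)) {0..pi/2}"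
      by (intro fundamental_theorem_of_calculus) auto
    then have L: "((\<lambda>u. sin u / (1 + cos u)) has_integral ln 2) {0..pi/2}" by simp
    have bound: "0 \<le> sin u / (1 + cos u) - (1 - cos u) / R u \<and>
                 sin u / (1 + cos u) - (1 - cos u) / R u \<le> sqrt m" if u: "u \<in> {0..pi/2}" for u
    proof -
      have s: "sin u \<ge> 0" using u by (intro sin_ge_zero) auto
      have c0: "cos u \<ge> 0" using u by (intro cos_ge_zero) auto
      have sR: "sin u \<le> R u" unfolding R_def using m s by (intro real_le_rsqrt) simp
      have Rs: "R u \<le> sqrt m + sin u"
        unfolding R_def using m s sqrt_add_le_add_sqrt[of m "(sin u)\<^sup>2"] by simp
      have "(1 - cos u) * (1 + cos u) = (sin u)\<^sup>2"
        using sin_cos_squared_add[of u] by (simp add: algebra_simps power2_eq_square)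
      then have "1 - cos u = (sin u)\<^sup>2 / (1 + cos u)"
        using c0 by (simp add: field_simps)
      then have eq: "sin u / (1 + cos u) - (1 - cos u) / R u
                 = (sin u / R u) * (1 / (1 + cos u)) * (R u - sin u)"
        using R(1)[of u] c0 by (simp add: field_simps power2_eq_square)
      have "(sin u / R u) * (1 / (1 + cos u)) * (R u - sin u) \<le> 1 * 1 * (R u - sin u)"
        using s sR c0 R(1)[of u] by (intro mult_right_mono mult_mono) (auto simp: field_simps)
      moreover have "0 \<le> (sin u / R u) * (1 / (1 + cos u)) * (R u - sin u)"
        using s sR c0 R(1)[of u] by auto
      ultimately show ?thesis unfolding eq using Rs by simp
    qed
    have D: "((\<lambda>u. sin u / (1 + cos u) - (1 - cos u) / R u) has_integral ln 2 - G m) {0..pi/2}"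
      by (rule has_integral_diff[OF L G])
    have "ln 2 - G m \<ge> 0"
      by (rule has_integral_nonneg[OF D]) (use bound in auto)
    moreover have "((\<lambda>_. sqrt m) has_integral (pi/2 - 0) *\<^sub>R sqrt m) {0..pi/2}"
      using has_integral_const_real[of "sqrt m" 0 "pi/2"] by simp
    from has_integral_le[OF D this] have "ln 2 - G m \<le> sqrt m * (pi/2)"
      using bound by (simp add: mult.commute)
    ultimately show "\<bar>G m - ln 2\<bar> \<le> sqrt m * (pi / 2)" by simp
  qed
  have pos: "\<forall>\<^sub>F m :: real in at_right 0. m > 0"
    by (simp add: eventually_at_right_less)
  have "((\<lambda>m. G m - ln 2) \<longlongrightarrow> 0) (at_right 0)"
  proof (rule Lim_null_comparison)
    show "\<forall>\<^sub>F m in at_right 0. norm (G m - ln 2) \<le> sqrt m * (pi / 2)"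
      using pos by eventually_elim (unfold real_norm_def, rule near)
    show "((\<lambda>m. sqrt m * (pi / 2)) \<longlongrightarrow> 0) (at_right 0)"
      by (auto intro!: tendsto_eq_intros)
  qed
  then have "(G \<longlongrightarrow> ln 2) (at_right 0)" by (simp add: LIM_zero_iff)
  moreover have "((\<lambda>m. ln (1 + sqrt (1 + m))) \<longlongrightarrow> ln 2) (at_right 0)"
    by (auto intro!: tendsto_eq_intros)
  ultimately have "((\<lambda>m. (ln (1 + sqrt (1 + m)) + G m) / 2) \<longlongrightarrow> (ln 2 + ln 2) / 2) (at_right 0)"
    by (intro tendsto_divide tendsto_add tendsto_const) auto
  then have "((\<lambda>m. (ln (1 + sqrt (1 + m)) + G m) / 2) \<longlongrightarrow> ln 2) (at_right 0)" by simp
  then show ?thesis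
    by (rule Lim_transform_eventually) (use pos in \<open>eventually_elim, simp add: split\<close>)
qed

lemma ell0_first_order:
  "((\<lambda>m. (ell0 m - (1 - m * ln m / 4 + (1 / 4 + ln 2) * m)) / m) \<longlongrightarrow> 0) (at_right 0)"
proof (rule lhopital_right_0)
  have pos: "\<forall>\<^sub>F m :: real in at_right 0. m > 0"
    by (simp add: eventually_at_right_less)
  have "((\<lambda>m :: real. 1 - m * ln m / 4 + (1 / 4 + ln 2) * m) \<longlongrightarrow> 1) (at_right 0)"
    by real_asymp
  from tendsto_diff[OF ell0_tendsto this]
  show "((\<lambda>m. ell0 m - (1 - m * ln m / 4 + (1 / 4 + ln 2) * m)) \<longlongrightarrow> 0) (at_right 0)" by simp
  show "\<forall>\<^sub>F m in at_right 0. ((\<lambda>m. ell0 m - (1 - m * ln m / 4 + (1 / 4 + ln 2) * m))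
          has_real_derivative (ell1 m + ln m / 4) - ln 2) (at m)"
    using pos by eventually_elim (auto intro!: derivative_eq_intros DERIV_ell0 simp: add_divide_distrib)
  show "((\<lambda>m. (ell1 m + ln m / 4 - ln 2) / 1) \<longlongrightarrow> 0) (at_right 0)"
    using ell1_tendsto by (simp add: LIM_zero_iff)
qed (auto simp: eventually_at_filter)

text \<open>L'Hopital's rule is applied twice.  After two differentiations the differential equation replaces
  \<open>ell2\<close> by \<open>ell0\<close>, for which the first-order expansion is enough.  The coefficient \<open>1/32\<close> of \<open>m\<^sup>2 ln m\<close>
  is the one for which the logarithms cancel in the second derivative, and \<open>3/64 - ln 2 / 8\<close> then
  removes the remaining constant.\<close>

lemma ell0_second_order:
  "((\<lambda>m. (ell0 m - (1 - m * ln m / 4 + (1 / 4 + ln 2) * m + m\<^sup>2 * ln m / 32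
        + (3 / 64 - ln 2 / 8) * m\<^sup>2)) / m\<^sup>2) \<longlongrightarrow> 0) (at_right 0)"
proof (rule lhopital_right_0)
  have pos: "\<forall>\<^sub>F m :: real in at_right 0. m > 0"
    by (simp add: eventually_at_right_less)
  have "((\<lambda>m :: real. 1 - m * ln m / 4 + (1 / 4 + ln 2) * m + m\<^sup>2 * ln m / 32
        + (3 / 64 - ln 2 / 8) * m\<^sup>2) \<longlongrightarrow> 1) (at_right 0)"
    by real_asymp
  from tendsto_diff[OF ell0_tendsto this]
  show "((\<lambda>m. ell0 m - (1 - m * ln m / 4 + (1 / 4 + ln 2) * m + m\<^sup>2 * ln m / 32
        + (3 / 64 - ln 2 / 8) * m\<^sup>2)) \<longlongrightarrow> 0) (at_right 0)" by simp
  show "\<forall>\<^sub>F m in at_right 0. ((\<lambda>m. ell0 m - (1 - m * ln m / 4 + (1 / 4 + ln 2) * m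
        + m\<^sup>2 * ln m / 32 + (3 / 64 - ln 2 / 8) * m\<^sup>2))
          has_real_derivative (ell1 m + ln m / 4 - ln 2)
             - (m * ln m / 16 + m / 32 + (3 / 32 - ln 2 / 4) * m)) (at m)"
    using pos
    by eventually_elim
       (auto intro!: derivative_eq_intros DERIV_ell0 simp: field_simps power2_eq_square)
  show "((\<lambda>m. (ell1 m + ln m / 4 - ln 2 - (m * ln m / 16 + m / 32 + (3 / 32 - ln 2 / 4) * m))
          / (2 * m)) \<longlongrightarrow> 0) (at_right 0)"
  proof (rule lhopital_right_0)
    have "((\<lambda>m :: real. m * ln m / 16 + m / 32 + (3 / 32 - ln 2 / 4) * m) \<longlongrightarrow> 0) (at_right 0)"
      by real_asymp
    from tendsto_diff[OF tendsto_diff[OF ell1_tendsto tendsto_const[of "ln 2"]] this]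
    show "((\<lambda>m. ell1 m + ln m / 4 - ln 2 - (m * ln m / 16 + m / 32 + (3 / 32 - ln 2 / 4) * m))
            \<longlongrightarrow> 0) (at_right 0)" by simp
    show "\<forall>\<^sub>F m in at_right 0. ((\<lambda>m. ell1 m + ln m / 4 - ln 2
              - (m * ln m / 16 + m / 32 + (3 / 32 - ln 2 / 4) * m)) has_real_derivative
            ell2 m + 1 / (4 * m) - (ln m / 16 + 1 / 16 + 1 / 32 + (3 / 32 - ln 2 / 4))) (at m)"
      using pos
      by eventually_elim (auto intro!: derivative_eq_intros DERIV_ell1 simp: field_simps)
    define e where "e m = (ell0 m - (1 - m * ln m / 4 + (1 / 4 + ln 2) * m)) / m" for m
    have e: "(e \<longlongrightarrow> 0) (at_right 0)" unfolding e_def by (rule ell0_first_order)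
    have mln: "((\<lambda>m :: real. m * ln m) \<longlongrightarrow> 0) (at_right 0)" by real_asymp
    have "((\<lambda>m. (3 / 4 - ln 2 - e m - m * ln m / 4) / (8 * (1 + m)) - (3 / 32 - ln 2 / 8)) \<longlongrightarrow>
            (3 / 4 - ln 2 - 0 - 0 / 4) / (8 * (1 + 0)) - (3 / 32 - ln 2 / 8)) (at_right 0)"
      by (intro tendsto_intros e mln) auto
    moreover have "(3 / 4 - ln 2 - 0 - 0 / 4) / (8 * (1 + 0)) - (3 / 32 - ln 2 / 8) = (0 :: real)"
      by (simp add: field_simps)
    ultimately have "((\<lambda>m. (3 / 4 - ln 2 - e m - m * ln m / 4) / (8 * (1 + m))
                        - (3 / 32 - ln 2 / 8)) \<longlongrightarrow> 0) (at_right 0)"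
      by (simp only:)
    then show "((\<lambda>m. (ell2 m + 1 / (4 * m) - (ln m / 16 + 1 / 16 + 1 / 32 + (3 / 32 - ln 2 / 4))) / 2)
                 \<longlongrightarrow> 0) (at_right 0)"
    proof (rule Lim_transform_eventually)
      show "\<forall>\<^sub>F m in at_right 0. (3 / 4 - ln 2 - e m - m * ln m / 4) / (8 * (1 + m)) - (3 / 32 - ln 2 / 8)
        = (ell2 m + 1 / (4 * m) - (ln m / 16 + 1 / 16 + 1 / 32 + (3 / 32 - ln 2 / 4))) / 2"
        using pos
      proof eventually_elim
        case (elim m)
        have "ell0 m = 1 - m * ln m / 4 + (1 / 4 + ln 2) * m + m * e m"
          using elim by (simp add: e_def)
        moreover have "ell2 m = - ell0 m / (4 * p)" if "p * ell2 m + ell0 m / 4 = 0" "p > 0" for p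
          using that by (simp add: field_simps)
        from this[OF ell_ode[OF elim]] have "ell2 m = - ell0 m / (4 * (m * (1 + m)))"
          using elim by simp
        ultimately have "ell2 m = - (1 - m * ln m / 4 + (1 / 4 + ln 2) * m + m * e m) / (4 * (m * (1 + m)))"
          by simp
        then show ?case using elim by (simp add: divide_simps) (simp add: algebra_simps)
      qed
    qed
    show "\<forall>\<^sub>F m in at_right 0. ((\<lambda>m. 2 * m) has_real_derivative 2) (at m)"
      by (intro always_eventually allI) (auto intro!: derivative_eq_intros)
  qed (auto simp: eventually_at_filter intro!: tendsto_eq_intros)
  show "\<forall>\<^sub>F m :: real in at_right 0. (power2 has_real_derivative 2 * m) (at m)"
    by (intro always_eventually allI) (auto intro!: derivative_eq_intros)
qed (auto simp: eventually_at_filter intro!: tendsto_eq_intros)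

section \<open>The action on the axis \<open>j2 = 0\<close>\<close>

lemma I1_even: "I1 h (- j2) = I1 h j2"
  by (simp add: I1_def are_roots_def cubic_def)

lemma the_roots_on_axis:
  assumes "h > 0"
  shows "(THE z. are_roots h 0 z) = (- 1, 1, 1 + h)"
proof (rule the_equality)
  show "are_roots h 0 (- 1, 1, 1 + h)"
    using assms by (auto simp: are_roots_def cubic_def power2_eq_square algebra_simps)
next
  fix z
  assume z: "are_roots h 0 z"
  obtain a b c where [simp]: "z = (a, b, c)" by (cases z) auto
  have abc: "- 1 \<le> a" "a \<le> b" "b \<le> 1" "1 \<le> c"
    and eq: "\<And>\<zeta>. cubic h 0 \<zeta> = 2 * (\<zeta> - a) * (\<zeta> - b) * (\<zeta> - c)"
    using z by (auto simp: are_roots_def)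
  have "cubic h 0 (1 + h) = 0" "cubic h 0 (- 1) = 0" "cubic h 0 1 = 0"
    by (simp_all add: cubic_def)
  then have "1 + h = a \<or> 1 + h = b \<or> 1 + h = c" "- 1 = a \<or> - 1 = b \<or> - 1 = c"
    "1 = a \<or> 1 = b \<or> 1 = c"
    unfolding eq by auto
  then show "z = (- 1, 1, 1 + h)"
    using abc assms by auto
qed

text \<open>The substitution \<open>\<zeta> = cos (2 u)\<close>.  The integrand is unbounded at \<open>\<zeta> = -1\<close> and at \<open>\<zeta> = 1\<close>, so the change of
  variables is made on the primitive, which is continuous on the closed interval.\<close>

lemma I1_on_axis:
  assumes h: "h > 0"
  shows "I1 h 0 = 4 * ell0 (h / 2) / pi"
proof -
  define R where "R u = sqrt (h / 2 + (sin u)\<^sup>2)" for u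
  define \<Psi> where "\<Psi> u = integral {0..u} R" for u
  have contR: "continuous_on {0..pi/2} R"
    unfolding R_def by (intro continuous_intros)
  have cont\<Psi>: "continuous_on {0..pi/2} \<Psi>"
    unfolding \<Psi>_def by (intro indefinite_integral_continuous_1 integrable_continuous_real contR)
  define g where "g \<zeta> = - 4 * \<Psi> (arccos \<zeta> / 2)" for \<zeta>
  have "((\<lambda>\<zeta>. sqrt (cubic h 0 \<zeta>) / (1 - \<zeta>\<^sup>2)) has_integral g 1 - g (- 1)) {- 1..1}"
  proof (rule fundamental_theorem_of_calculus_interior)
    have "continuous_on {- 1..1} (\<lambda>\<zeta>. \<Psi> (arccos \<zeta> / 2))"
    proof (rule continuous_on_compose2[OF cont\<Psi>])
      show "continuous_on {- 1..1} (\<lambda>\<zeta>. arccos \<zeta> / 2)"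
        by (intro continuous_intros) auto
      show "(\<lambda>\<zeta>. arccos \<zeta> / 2) ` {- 1..1} \<subseteq> {0..pi / 2}"
        using arccos_lbound arccos_ubound by auto
    qed
    then show "continuous_on {- 1..1} g"
      unfolding g_def by (intro continuous_intros)
  next
    fix \<zeta> :: real
    assume \<zeta>: "\<zeta> \<in> {- 1<..<1}"
    define \<theta> where "\<theta> = arccos \<zeta>"
    have \<theta>: "0 < \<theta>" "\<theta> < pi" "cos \<theta> = \<zeta>"
      using \<zeta> arccos_lt_bounded[of \<zeta>] by (auto simp: \<theta>_def)
    have pos: "1 - \<zeta>\<^sup>2 > 0" using \<zeta> by (simp add: abs_square_less_1 abs_less_iff)
    have "(\<Psi> has_vector_derivative R (\<theta> / 2)) (at (\<theta> / 2) within {0..pi/2})"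
      unfolding \<Psi>_def using \<theta> by (intro integral_has_vector_derivative contR) auto
    then have "(\<Psi> has_real_derivative R (\<theta> / 2)) (at (\<theta> / 2))"
      using \<theta> by (simp add: has_real_derivative_iff_has_vector_derivative at_within_Icc_at)
    moreover have "((\<lambda>\<zeta>. arccos \<zeta> / 2) has_real_derivative inverse (- sqrt (1 - \<zeta>\<^sup>2)) / 2) (at \<zeta>)"
      using \<zeta> by (intro DERIV_cdivide DERIV_arccos) auto
    ultimately have "((\<lambda>\<zeta>. \<Psi> (arccos \<zeta> / 2)) has_real_derivative
                        R (\<theta> / 2) * (inverse (- sqrt (1 - \<zeta>\<^sup>2)) / 2)) (at \<zeta>)"
      unfolding \<theta>_def by (rule DERIV_chain2)
    then have "(g has_real_derivative - 4 * (R (\<theta> / 2) * (inverse (- sqrt (1 - \<zeta>\<^sup>2)) / 2))) (at \<zeta>)"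
      unfolding g_def by (rule DERIV_cmult)
    moreover have "- 4 * (R (\<theta> / 2) * (inverse (- sqrt (1 - \<zeta>\<^sup>2)) / 2))
                   = sqrt (cubic h 0 \<zeta>) / (1 - \<zeta>\<^sup>2)"
    proof -
      have "cos (2 * (\<theta> / 2)) = 1 - 2 * (sin (\<theta> / 2))\<^sup>2"
        by (rule cos_double_sin)
      then have "(sin (\<theta> / 2))\<^sup>2 = (1 - \<zeta>) / 2" using \<theta>(3) by simp
      then have "R (\<theta> / 2) = sqrt ((h + 1 - \<zeta>) / 2)"
        by (simp add: R_def add_divide_distrib diff_divide_distrib)
      also have "\<dots> = sqrt (2 * (h + 1 - \<zeta>) / 4)" by simp
      also have "\<dots> = sqrt (2 * (h + 1 - \<zeta>)) / 2" by (simp add: real_sqrt_divide)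
      finally have R: "2 * R (\<theta> / 2) = sqrt (2 * (h + 1 - \<zeta>))" by simp
      have "cubic h 0 \<zeta> = (1 - \<zeta>\<^sup>2) * (2 * (h + 1 - \<zeta>))"
        by (simp add: cubic_def algebra_simps)
      then have "sqrt (cubic h 0 \<zeta>) / (1 - \<zeta>\<^sup>2)
            = sqrt ((1 - \<zeta>\<^sup>2) * (2 * (h + 1 - \<zeta>))) / (sqrt (1 - \<zeta>\<^sup>2) * sqrt (1 - \<zeta>\<^sup>2))"
        using pos by simp
      also have "\<dots> = sqrt (2 * (h + 1 - \<zeta>)) / sqrt (1 - \<zeta>\<^sup>2)"
        unfolding real_sqrt_mult using pos by (intro mult_divide_mult_cancel_left) simp
      also have "\<dots> = 2 * R (\<theta> / 2) / sqrt (1 - \<zeta>\<^sup>2)" by (simp only: R)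
      finally show ?thesis by (simp add: field_simps)
    qed
    ultimately show "(g has_vector_derivative sqrt (cubic h 0 \<zeta>) / (1 - \<zeta>\<^sup>2)) (at \<zeta>)"
      by (simp add: has_real_derivative_iff_has_vector_derivative)
  qed simp
  moreover have "g 1 - g (- 1) = 4 * ell0 (h / 2)"
    by (simp add: g_def \<Psi>_def ell0_def R_def[abs_def])
  ultimately have "integral {- 1..1} (\<lambda>\<zeta>. sqrt (cubic h 0 \<zeta>) / (1 - \<zeta>\<^sup>2)) = 4 * ell0 (h / 2)"
    by (auto intro: integral_unique)
  then show ?thesis
    by (simp add: I1_def the_roots_on_axis[OF h])
qed

lemma I1_on_axis_expansion:
  "(\<lambda>h. 2 * pi * I1 h 0 - (8 + singular_action 0 h + ln 32 * h + h\<^sup>2 * ln h / 16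
         + (3 / 32 - ln 32 / 16) * h\<^sup>2)) \<in> o[at_right 0](\<lambda>h. h\<^sup>2)"
proof -
  define r where "r m = ell0 m - (1 - m * ln m / 4 + (1 / 4 + ln 2) * m + m\<^sup>2 * ln m / 32
        + (3 / 64 - ln 2 / 8) * m\<^sup>2)" for m
  have "r \<in> o[at_right 0](\<lambda>m. m\<^sup>2)"
    by (rule smalloI_tendsto) (use ell0_second_order in \<open>auto simp: r_def eventually_at_filter\<close>)
  moreover have "filterlim (\<lambda>h :: real. h / 2) (at_right 0) (at_right 0)"
    by real_asymp
  ultimately have "(\<lambda>h. r (h / 2)) \<in> o[at_right 0](\<lambda>h. (h / 2)\<^sup>2)"
    by (rule landau_o.small.compose)
  then have "(\<lambda>h. 8 * r (h / 2)) \<in> o[at_right 0](\<lambda>h. h\<^sup>2)"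
    by (simp add: power_divide)
  moreover have "\<forall>\<^sub>F h in at_right 0. 8 * r (h / 2) =
      2 * pi * I1 h 0 - (8 + singular_action 0 h + ln 32 * h + h\<^sup>2 * ln h / 16
         + (3 / 32 - ln 32 / 16) * h\<^sup>2)"
    using eventually_at_right_less[of 0]
  proof eventually_elim
    case (elim h)
    have "ln (h / 2) = ln h - ln 2" using elim by (simp add: ln_div)
    moreover have "ln 32 = 5 * ln (2 :: real)"
      using ln_realpow[of 2 5] by simp
    moreover have "singular_action 0 h = - h * ln h + h"
      using elim by (simp add: singular_action_def complex_norm)
    ultimately show ?case
      using elim by (simp add: r_def I1_on_axis) (simp add: field_simps power2_eq_square)
  qed
  ultimately show ?thesis
    by (rule landau_o.small.in_cong[THEN iffD1, rotated])
qed

section \<open>Comparison of coefficients\<close>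

text \<open>The functions \<open>1, t, t\<^sup>2 ln t, t\<^sup>2\<close> are listed by strictly decreasing order of magnitude at \<open>0\<close>, so
  dividing by each in turn isolates one coefficient after the other.\<close>

lemma log_polynomial_coeffs_zero:
  fixes \<alpha> \<beta> \<gamma> \<delta> :: real
  assumes "(\<lambda>t. \<alpha> + \<beta> * t + \<gamma> * (t\<^sup>2 * ln t) + \<delta> * t\<^sup>2) \<in> o[at_right 0](\<lambda>t. t\<^sup>2)"
  shows "\<alpha> = 0" "\<beta> = 0" "\<gamma> = 0" "\<delta> = 0"
proof -
  let ?e = "\<lambda>t. \<alpha> + \<beta> * t + \<gamma> * (t\<^sup>2 * ln t) + \<delta> * t\<^sup>2"
  have limit: "c = 0" if "((\<lambda>t. ?e t / g t) \<longlongrightarrow> c) (at_right 0)" "(\<lambda>t. t\<^sup>2) \<in> O[at_right 0](g)" for c g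
    using smalloD_tendsto[OF landau_o.small_big_trans[OF assms that(2)]] that(1)
      tendsto_unique[OF trivial_limit_at_right_real] by blast
  show \<alpha>: "\<alpha> = 0"
    by (rule limit[of "\<lambda>_. 1"]) real_asymp+
  show \<beta>: "\<beta> = 0"
    by (rule limit[of "\<lambda>t. t"]) (simp only: \<alpha>, real_asymp, real_asymp)
  show \<gamma>: "\<gamma> = 0"
    by (rule limit[of "\<lambda>t. t\<^sup>2 * ln t"]) (simp only: \<alpha> \<beta>, real_asymp, real_asymp)
  show "\<delta> = 0"
    by (rule limit[of "\<lambda>t. t\<^sup>2"]) (simp only: \<alpha> \<beta> \<gamma>, real_asymp, real_asymp)
qed

text \<open>Let \<open>u = \<H>(t, 0)\<close> and let \<open>A\<close> be the coefficient of \<open>t\<^sup>2\<close> in \<open>u\<close>.  The hypothesis and the expansion of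
  the action, taken at \<open>h = u\<close>, express the same function of \<open>t\<close>.  Replacing \<open>u\<close> by \<open>t + A t\<^sup>2\<close> turns
  their difference into a combination of \<open>1, t, t\<^sup>2 ln t, t\<^sup>2\<close>; the term \<open>- A t\<^sup>2 ln t\<close> comes from the
  singular part and must cancel \<open>t\<^sup>2 ln t / 16\<close>.\<close>

lemma coeffs_on_axis:
  assumes H: "power_series2 a H" "a (0, 0) = 0" "a (1, 0) = 1"
    and S: "power_series2 s S"
    and action: "\<forall>\<^sub>F t in at_right 0. 2 * pi * I1 (H (t, 0)) 0 = 8 + singular_action 0 t + S (t, 0)"
  shows "a (2, 0) = 1 / 16" "s (1, 0) = ln 32" "s (2, 0) = 3 / 32"
proof -
  define u \<sigma> where "u t = H (t, 0)" and "\<sigma> t = S (t, 0)" for t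
  define A where "A = a (2, 0)"
  have zero: "(\<lambda>_. 0) \<in> O[at_right 0](\<lambda>t::real. t)" by simp
  have cubic_small: "(\<lambda>t::real. t ^ 3) \<in> o[at_right 0](\<lambda>t. t\<^sup>2)" by real_asymp
  have u3: "(\<lambda>t. u t - t - A * t\<^sup>2) \<in> O[at_right 0](\<lambda>t. t ^ 3)"
    using power_series2_along_curve[OF H(1) landau_o.big_refl zero]
    by (simp add: H(2) H(3)[unfolded One_nat_def] u_def A_def diff_diff_eq)
  have \<sigma>: "(\<lambda>t. \<sigma> t - (s (0, 0) + s (1, 0) * t + s (2, 0) * t\<^sup>2)) \<in> o[at_right 0](\<lambda>t. t\<^sup>2)"
    using landau_o.big_small_trans[OF power_series2_along_curve[OF S landau_o.big_refl zero] cubic_small]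
    by (simp add: \<sigma>_def)
  note u2 = near_identity_curve(1)[OF u3] and uO = near_identity_curve(2)[OF u3]
    and ratio = near_identity_curve(3)[OF u3]
  have pos: "\<forall>\<^sub>F t::real in at_right 0. t > 0" by (rule eventually_at_right_less)
  have upos: "\<forall>\<^sub>F t in at_right 0. u t > 0"
    using order_tendstoD(1)[OF ratio zero_less_one] pos
    by eventually_elim (simp add: zero_less_divide_iff)
  from near_identity_curve(4)[OF u3] have "filterlim u (at_right 0) (at_right 0)"
    using upos by (auto simp: filterlim_at elim: eventually_mono)
  then have exp: "(\<lambda>t. 2 * pi * I1 (u t) 0 - (8 + singular_action 0 (u t) + ln 32 * u t
         + (u t)\<^sup>2 * ln (u t) / 16 + (3 / 32 - ln 32 / 16) * (u t)\<^sup>2)) \<in> o[at_right 0](\<lambda>t. (u t)\<^sup>2)"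
    by (rule landau_o.small.compose[OF I1_on_axis_expansion])
  have u2O: "(\<lambda>t. (u t)\<^sup>2) \<in> O[at_right 0](\<lambda>t. t\<^sup>2)"
    using landau_o.big_power[OF uO, of 2] .
  note exp = landau_o.small_big_trans[OF exp u2O]
  have inc: "(\<lambda>t. singular_action 0 (u t) - singular_action 0 t + A * t\<^sup>2 * ln t)
              \<in> o[at_right 0](\<lambda>t. t\<^sup>2)"
    using singular_action_increment[OF u3, of 0] by simp
  have sq: "(\<lambda>t. (u t)\<^sup>2 - t\<^sup>2) \<in> O[at_right 0](\<lambda>t. t ^ 3)"
  proof -
    have "(\<lambda>t. (u t - t) * (u t + t)) \<in> O[at_right 0](\<lambda>t. t\<^sup>2 * t)"
      by (intro landau_o.big.mult u2 sum_in_bigo uO) simp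
    then show ?thesis by (simp add: power2_eq_square power3_eq_cube algebra_simps)
  qed
  have sqln: "(\<lambda>t. (u t)\<^sup>2 * ln (u t) - t\<^sup>2 * ln t) \<in> o[at_right 0](\<lambda>t. t\<^sup>2)"
  proof -
    have "(\<lambda>t. ((u t)\<^sup>2 - t\<^sup>2) * ln t) \<in> O[at_right 0](\<lambda>t. t ^ 3 * ln t)"
      by (intro landau_o.big.mult sq) simp
    also have "(\<lambda>t::real. t ^ 3 * ln t) \<in> o[at_right 0](\<lambda>t. t\<^sup>2)" by real_asymp
    finally have 1: "(\<lambda>t. ((u t)\<^sup>2 - t\<^sup>2) * ln t) \<in> o[at_right 0](\<lambda>t. t\<^sup>2)" .
    have "((\<lambda>t. ln (u t / t)) \<longlongrightarrow> ln 1) (at_right 0)"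
      by (intro tendsto_ln ratio) simp
    then have "(\<lambda>t. ln (u t / t)) \<in> o[at_right 0](\<lambda>_. 1)"
      by (intro smalloI_tendsto) auto
    from landau_o.big_small_mult[OF u2O this]
    have 2: "(\<lambda>t. (u t)\<^sup>2 * ln (u t / t)) \<in> o[at_right 0](\<lambda>t. t\<^sup>2)" by simp
    have "\<forall>\<^sub>F t in at_right 0. ((u t)\<^sup>2 - t\<^sup>2) * ln t + (u t)\<^sup>2 * ln (u t / t)
            = (u t)\<^sup>2 * ln (u t) - t\<^sup>2 * ln t"
      using pos upos by eventually_elim (simp add: ln_div algebra_simps)
    from landau_o.small.in_cong[OF this] sum_in_smallo(1)[OF 1 2] show ?thesis by blast
  qed
  have sq': "(\<lambda>t. (3 / 32 - ln 32 / 16) * ((u t)\<^sup>2 - t\<^sup>2)) \<in> o[at_right 0](\<lambda>t. t\<^sup>2)"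
    using landau_o.big_small_trans[OF sq cubic_small] by simp
  have u3': "(\<lambda>t. ln 32 * (u t - t - A * t\<^sup>2)) \<in> o[at_right 0](\<lambda>t. t\<^sup>2)"
    using landau_o.big_small_trans[OF u3 cubic_small] by simp
  have sqln': "(\<lambda>t. 1 / 16 * ((u t)\<^sup>2 * ln (u t) - t\<^sup>2 * ln t)) \<in> o[at_right 0](\<lambda>t. t\<^sup>2)"
    using sqln by simp
  note total = sum_in_smallo(2)[OF sum_in_smallo(1)[OF sum_in_smallo(1)[OF sum_in_smallo(1)[OF
      sum_in_smallo(1)[OF exp inc] u3'] sqln'] sq'] \<sigma>]
  have "(\<lambda>t. s (0, 0) + (s (1, 0) - ln 32) * t + (A - 1 / 16) * (t\<^sup>2 * ln t)
             + (s (2, 0) - ln 32 * A - (3 / 32 - ln 32 / 16)) * t\<^sup>2) \<in> o[at_right 0](\<lambda>t. t\<^sup>2)"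
  proof (rule landau_o.small.in_cong[THEN iffD1, OF _ total])
    show "\<forall>\<^sub>F t in at_right 0. 2 * pi * I1 (u t) 0 - (8 + singular_action 0 (u t) + ln 32 * u t
         + (u t)\<^sup>2 * ln (u t) / 16 + (3 / 32 - ln 32 / 16) * (u t)\<^sup>2)
         + (singular_action 0 (u t) - singular_action 0 t + A * t\<^sup>2 * ln t)
         + ln 32 * (u t - t - A * t\<^sup>2)
         + 1 / 16 * ((u t)\<^sup>2 * ln (u t) - t\<^sup>2 * ln t)
         + (3 / 32 - ln 32 / 16) * ((u t)\<^sup>2 - t\<^sup>2)
         - (\<sigma> t - (s (0, 0) + s (1, 0) * t + s (2, 0) * t\<^sup>2))
        = s (0, 0) + (s (1, 0) - ln 32) * t + (A - 1 / 16) * (t\<^sup>2 * ln t)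
             + (s (2, 0) - ln 32 * A - (3 / 32 - ln 32 / 16)) * t\<^sup>2"
      using action
    proof eventually_elim
      case (elim t)
      then have "2 * pi * I1 (u t) 0 = 8 + singular_action 0 t + \<sigma> t"
        by (simp add: u_def \<sigma>_def)
      then show ?case by (simp only:) (simp add: field_simps)
    qed
  qed
  note c = log_polynomial_coeffs_zero[OF this]
  from c(2) show "s (1, 0) = ln 32" by simp
  from c(3) show A: "a (2, 0) = 1 / 16" by (simp add: A_def)
  from c(4) A show "s (2, 0) = 3 / 32" by (simp add: A_def)
qed

text \<open>At the points \<open>(t + k t\<^sup>2, -t)\<close> the function \<open>H\<close> exceeds \<open>H (t, t)\<close> by \<open>(k - 2 a(1,1)) t\<^sup>2 + O(t\<^sup>3)\<close>.  For
  \<open>k = M\<close> and \<open>k = -M\<close> with \<open>M > 2 \<bar>a(1,1)\<bar>\<close> the signs differ, so the intermediate value theorem gives a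
  solution with \<open>v t - t = O(t\<^sup>2)\<close>; inserting this into the Taylor polynomial determines its \<open>t\<^sup>2\<close> term.\<close>

lemma reflected_point:
  assumes H: "power_series2 a H" "a (0, 0) = 0" "a (1, 0) = 1" "a (0, 1) = 0"
  obtains v where "(\<lambda>t. v t - t - 2 * a (1, 1) * t\<^sup>2) \<in> O[at_right 0](\<lambda>t. t ^ 3)"
    "\<forall>\<^sub>F t in at_right 0. H (v t, - t) = H (t, t)"
proof -
  note H' = H(2) H(3,4)[unfolded One_nat_def]
  define M where "M = 2 * \<bar>a (1, 1)\<bar> + 1"
  have M: "M - 2 * a (1, 1) > 0" "- M - 2 * a (1, 1) < 0" by (auto simp: M_def)
  have pos: "\<forall>\<^sub>F t::real in at_right 0. t > 0" by (rule eventually_at_right_less)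
  have cubic_small: "(\<lambda>t::real. t ^ 3) \<in> o[at_right 0](\<lambda>t. t\<^sup>2)" by real_asymp
  have diag: "(\<lambda>t. H (t, t) - (t + (a (2, 0) + a (1, 1) + a (0, 2)) * t\<^sup>2)) \<in> O[at_right 0](\<lambda>t. t ^ 3)"
    using power_series2_along_curve[OF H(1) landau_o.big_refl landau_o.big_refl]
    by (simp add: H' algebra_simps power2_eq_square)
  have anti: "(\<lambda>t. H (v t, - t) - (v t + (a (2, 0) - a (1, 1) + a (0, 2)) * t\<^sup>2))
                \<in> O[at_right 0](\<lambda>t. t ^ 3)"
    if v: "(\<lambda>t. v t - t) \<in> O[at_right 0](\<lambda>t. t\<^sup>2)" for v
  proof -
    have "(\<lambda>t::real. t\<^sup>2) \<in> O[at_right 0](\<lambda>t. t)" by real_asymp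
    note v1 = landau_o.big_trans[OF v this]
    have "(\<lambda>t. (v t - t) + t) \<in> O[at_right 0](\<lambda>t. t)"
      by (intro sum_in_bigo v1) simp
    then have vO: "v \<in> O[at_right 0](\<lambda>t. t)" by simp
    have 1: "(\<lambda>t. H (v t, - t) - (v t + a (2, 0) * (v t)\<^sup>2 - a (1, 1) * v t * t + a (0, 2) * t\<^sup>2))
                \<in> O[at_right 0](\<lambda>t. t ^ 3)"
      using power_series2_along_curve[OF H(1) vO, of uminus] by (simp add: H')
    have "(\<lambda>t. (v t - t) * (a (2, 0) * (v t + t) - a (1, 1) * t)) \<in> O[at_right 0](\<lambda>t. t\<^sup>2 * t)"
      by (intro landau_o.big.mult v sum_in_bigo) (use vO in \<open>auto intro!: sum_in_bigo\<close>)
    then have 2: "(\<lambda>t. (v t - t) * (a (2, 0) * (v t + t) - a (1, 1) * t)) \<in> O[at_right 0](\<lambda>t. t ^ 3)"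
      by (simp add: power2_eq_square power3_eq_cube)
    from sum_in_bigo(1)[OF 1 2] show ?thesis
      by (simp add: algebra_simps power2_eq_square)
  qed
  have shift: "((\<lambda>t. (H (t + k * t\<^sup>2, - t) - H (t, t)) / t\<^sup>2) \<longlongrightarrow> k - 2 * a (1, 1)) (at_right 0)" for k
  proof -
    have "(\<lambda>t. H (t + k * t\<^sup>2, - t) - (t + k * t\<^sup>2 + (a (2, 0) - a (1, 1) + a (0, 2)) * t\<^sup>2))
                \<in> O[at_right 0](\<lambda>t. t ^ 3)"
      by (rule anti) simp
    from smalloD_tendsto[OF landau_o.big_small_trans[OF sum_in_bigo(2)[OF this diag] cubic_small]]
    have "((\<lambda>t. (H (t + k * t\<^sup>2, - t) - (t + k * t\<^sup>2 + (a (2, 0) - a (1, 1) + a (0, 2)) * t\<^sup>2)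
             - (H (t, t) - (t + (a (2, 0) + a (1, 1) + a (0, 2)) * t\<^sup>2))) / t\<^sup>2 + (k - 2 * a (1, 1)))
            \<longlongrightarrow> 0 + (k - 2 * a (1, 1))) (at_right 0)"
      by (intro tendsto_add tendsto_const)
    then have "((\<lambda>t. (H (t + k * t\<^sup>2, - t) - (t + k * t\<^sup>2 + (a (2, 0) - a (1, 1) + a (0, 2)) * t\<^sup>2)
             - (H (t, t) - (t + (a (2, 0) + a (1, 1) + a (0, 2)) * t\<^sup>2))) / t\<^sup>2 + (k - 2 * a (1, 1)))
            \<longlongrightarrow> k - 2 * a (1, 1)) (at_right 0)" by simp
    then show ?thesis
      by (rule Lim_transform_eventually)
         (use pos in \<open>eventually_elim, simp add: field_simps\<close>)
  qed
  have above: "\<forall>\<^sub>F t in at_right 0. H (t + M * t\<^sup>2, - t) > H (t, t)"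
    using order_tendstoD(1)[OF shift M(1)] pos
    by eventually_elim (simp add: zero_less_divide_iff)
  have below: "\<forall>\<^sub>F t in at_right 0. H (t - M * t\<^sup>2, - t) < H (t, t)"
    using order_tendstoD(2)[OF shift M(2)] pos
    by eventually_elim (simp add: divide_less_0_iff)
  obtain r where r: "r > 0" and
    dH: "\<And>x y. \<bar>x\<bar> \<le> r \<Longrightarrow> \<bar>y\<bar> \<le> r \<Longrightarrow> ((\<lambda>x. H (x, y)) has_real_derivative partial1 H (x, y)) (at x)"
    using power_series2_partial1(2)[OF H(1)] unfolding eventually_nhds_0_box by auto
  have "((\<lambda>t. t + M * t\<^sup>2) \<longlongrightarrow> 0) (at_right 0)"
    by real_asymp
  then have small: "\<forall>\<^sub>F t in at_right 0. t + M * t\<^sup>2 < r"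
    using r by (rule order_tendstoD(2))
  have ex: "\<forall>\<^sub>F t in at_right 0. \<exists>x. \<bar>x - t\<bar> \<le> M * t\<^sup>2 \<and> H (x, - t) = H (t, t)"
    using above below small pos
  proof eventually_elim
    case (elim t)
    have Mt: "0 \<le> M * t\<^sup>2" by (simp add: M_def)
    have "continuous_on {t - M * t\<^sup>2..t + M * t\<^sup>2} (\<lambda>x. H (x, - t))"
    proof (intro continuous_at_imp_continuous_on ballI)
      fix x assume "x \<in> {t - M * t\<^sup>2..t + M * t\<^sup>2}"
      then show "isCont (\<lambda>x. H (x, - t)) x"
        using elim Mt by (intro DERIV_isCont[OF dH]) auto
    qed
    then obtain x where "t - M * t\<^sup>2 \<le> x" "x \<le> t + M * t\<^sup>2" "H (x, - t) = H (t, t)"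
      using IVT'[of "\<lambda>x. H (x, - t)" "t - M * t\<^sup>2" "H (t, t)" "t + M * t\<^sup>2"] elim Mt by auto
    then show ?case by (intro exI[of _ x]) auto
  qed
  define v where "v t = (SOME x. \<bar>x - t\<bar> \<le> M * t\<^sup>2 \<and> H (x, - t) = H (t, t))" for t
  have v: "\<forall>\<^sub>F t in at_right 0. \<bar>v t - t\<bar> \<le> M * t\<^sup>2 \<and> H (v t, - t) = H (t, t)"
    using ex unfolding v_def by eventually_elim (rule someI_ex)
  then have eq: "\<forall>\<^sub>F t in at_right 0. H (v t, - t) = H (t, t)"
    by (auto elim: eventually_mono)
  have "(\<lambda>t. v t - t) \<in> O[at_right 0](\<lambda>t. t\<^sup>2)"
    by (rule bigoI[of _ M]) (use v in \<open>auto elim: eventually_mono\<close>)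
  from sum_in_bigo(2)[OF diag anti[OF this]]
  have "(\<lambda>t. v t - t - 2 * a (1, 1) * t\<^sup>2) \<in> O[at_right 0](\<lambda>t. t ^ 3)"
  proof (rule landau_o.big.in_cong[THEN iffD1, rotated])
    show "\<forall>\<^sub>F t in at_right 0. H (t, t) - (t + (a (2, 0) + a (1, 1) + a (0, 2)) * t\<^sup>2) -
             (H (v t, - t) - (v t + (a (2, 0) - a (1, 1) + a (0, 2)) * t\<^sup>2))
           = v t - t - 2 * a (1, 1) * t\<^sup>2"
      using eq by eventually_elim (simp add: algebra_simps)
  qed
  from this eq show ?thesis by (rule that)
qed

text \<open>The points \<open>(t, t)\<close> and \<open>(v t, -t)\<close> have the same energy and opposite angular momentum, hence the same
  action.  The singular parts differ by \<open>- 2 a(1,1) t\<^sup>2 ln t\<close> to leading order, the regular parts only by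
  powers of \<open>t\<close>.  So \<open>a(1,1)\<close> vanishes; then \<open>v t = t + O(t\<^sup>3)\<close>, and the \<open>t\<^sup>2\<close> term in the
  difference of the regular parts is a multiple of \<open>s(1,1)\<close>.\<close>

lemma coeffs_off_axis:
  assumes H: "power_series2 a H" "a (0, 0) = 0" "a (1, 0) = 1" "a (0, 1) = 0"
    and S: "power_series2 s S"
    and action: "\<forall>\<^sub>F z in nhds 0. z \<noteq> 0 \<longrightarrow> 2 * pi * I1 (H z) (snd z)
           = 8 - 2 * pi * \<bar>snd z\<bar> + singular_action (snd z) (fst z) + S z"
  shows "a (1, 1) = 0" "s (1, 1) = 0"
proof -
  define c where "c = 2 * a (1, 1)"
  obtain v where v: "(\<lambda>t. v t - t - c * t\<^sup>2) \<in> O[at_right 0](\<lambda>t. t ^ 3)"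
    and Hv: "\<forall>\<^sub>F t in at_right 0. H (v t, - t) = H (t, t)"
    using reflected_point[OF H] unfolding c_def by blast
  have pos: "\<forall>\<^sub>F t::real in at_right 0. t > 0" by (rule eventually_at_right_less)
  have cubic_small: "(\<lambda>t::real. t ^ 3) \<in> o[at_right 0](\<lambda>t. t\<^sup>2)" by real_asymp
  note v2 = near_identity_curve(1)[OF v] and vO = near_identity_curve(2)[OF v]
    and v0 = near_identity_curve(4)[OF v]
  have balance: "\<forall>\<^sub>F t in at_right 0.
      singular_action t (v t) + S (v t, - t) = singular_action t t + S (t, t)"
  proof -
    have "filterlim (\<lambda>t. (v t, - t)) (nhds 0) (at_right 0)"
      unfolding zero_prod_def using v0 by (auto intro!: tendsto_eq_intros)
    from eventually_compose_filterlim[OF action this]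
    have 1: "\<forall>\<^sub>F t in at_right 0. (v t, - t) \<noteq> 0 \<longrightarrow> 2 * pi * I1 (H (v t, - t)) (- t)
           = 8 - 2 * pi * \<bar>- t\<bar> + singular_action (- t) (v t) + S (v t, - t)" by simp
    have "filterlim (\<lambda>t::real. (t, t)) (nhds 0) (at_right 0)"
      unfolding zero_prod_def by (auto intro!: tendsto_eq_intros)
    from eventually_compose_filterlim[OF action this]
    have 2: "\<forall>\<^sub>F t in at_right 0. (t, t) \<noteq> 0 \<longrightarrow> 2 * pi * I1 (H (t, t)) t
           = 8 - 2 * pi * \<bar>t\<bar> + singular_action t t + S (t, t)" by simp
    from 1 2 Hv pos show ?thesis
      by eventually_elim (simp add: zero_prod_def I1_even singular_action_minus)
  qed
  have inc: "(\<lambda>t. singular_action t (v t) - singular_action t t + c * t\<^sup>2 * ln t + c * ln 2 / 2 * t\<^sup>2)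
               \<in> o[at_right 0](\<lambda>t. t\<^sup>2)"
    using singular_action_increment[OF v, of 1] by simp
  have S1: "(\<lambda>t. S (t, t) - (s (0, 0) + s (1, 0) * t + s (0, 1) * t
             + s (2, 0) * t\<^sup>2 + s (1, 1) * t * t + s (0, 2) * t\<^sup>2)) \<in> O[at_right 0](\<lambda>t. t ^ 3)"
    using power_series2_along_curve[OF S landau_o.big_refl landau_o.big_refl] .
  have S2: "(\<lambda>t. S (v t, - t) - (s (0, 0) + s (1, 0) * v t + s (0, 1) * - t
             + s (2, 0) * (v t)\<^sup>2 + s (1, 1) * v t * - t + s (0, 2) * (- t)\<^sup>2)) \<in> O[at_right 0](\<lambda>t. t ^ 3)"
    by (rule power_series2_along_curve[OF S vO]) simp
  have "(\<lambda>t. (v t - t) * (s (2, 0) * (v t + t) - s (1, 1) * t)) \<in> O[at_right 0](\<lambda>t. t\<^sup>2 * t)"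
    by (intro landau_o.big.mult v2 sum_in_bigo) (use vO in \<open>auto intro!: sum_in_bigo\<close>)
  then have S3: "(\<lambda>t. (v t - t) * (s (2, 0) * (v t + t) - s (1, 1) * t)) \<in> O[at_right 0](\<lambda>t. t ^ 3)"
    by (simp add: power2_eq_square power3_eq_cube)
  have S4: "(\<lambda>t. s (1, 0) * (v t - t - c * t\<^sup>2)) \<in> O[at_right 0](\<lambda>t. t ^ 3)"
    using v by simp
  note S_total = landau_o.big_small_trans[OF
      sum_in_bigo(1)[OF sum_in_bigo(1)[OF sum_in_bigo(2)[OF S2 S1] S3] S4] cubic_small]
  have "(\<lambda>t. 0 + 2 * s (0, 1) * t + c * (t\<^sup>2 * ln t)
           + (c * ln 2 / 2 + 2 * s (1, 1) - s (1, 0) * c) * t\<^sup>2) \<in> o[at_right 0](\<lambda>t. t\<^sup>2)"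
  proof (rule landau_o.small.in_cong[THEN iffD1, OF _ sum_in_smallo(1)[OF inc S_total]])
    show "\<forall>\<^sub>F t in at_right 0.
       singular_action t (v t) - singular_action t t + c * t\<^sup>2 * ln t + c * ln 2 / 2 * t\<^sup>2
       + (S (v t, - t) - (s (0, 0) + s (1, 0) * v t + s (0, 1) * - t
             + s (2, 0) * (v t)\<^sup>2 + s (1, 1) * v t * - t + s (0, 2) * (- t)\<^sup>2)
        - (S (t, t) - (s (0, 0) + s (1, 0) * t + s (0, 1) * t
             + s (2, 0) * t\<^sup>2 + s (1, 1) * t * t + s (0, 2) * t\<^sup>2))
        + (v t - t) * (s (2, 0) * (v t + t) - s (1, 1) * t)
        + s (1, 0) * (v t - t - c * t\<^sup>2))
       = 0 + 2 * s (0, 1) * t + c * (t\<^sup>2 * ln t)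
           + (c * ln 2 / 2 + 2 * s (1, 1) - s (1, 0) * c) * t\<^sup>2"
      using balance
    proof eventually_elim
      case (elim t)
      then have "S (v t, - t) = singular_action t t + S (t, t) - singular_action t (v t)"
        by simp
      then show ?case by (simp only:) (simp add: algebra_simps power2_eq_square)
    qed
  qed
  note coeffs = log_polynomial_coeffs_zero[OF this]
  from coeffs(3) show "a (1, 1) = 0" by (simp add: c_def)
  from coeffs(3,4) show "s (1, 1) = 0" by simp
qed


section \<open>The period\<close>

theorem mainTheorem5:
  fixes \<H> S :: "real \<times> real \<Rightarrow> real"
    and \<Phi> :: "(real^2) \<times> (real^2) \<Rightarrow> (real^3) \<times> (real^3)"
    and U :: "((real^2) \<times> (real^2)) set"
  assumes "eliasson_coordinates U \<Phi> \<H>"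
    and "semi_global_invariant \<H> S"
  shows "\<exists>R Q. bigO_deg 2 R \<and> bigO_deg 2 Q \<and>
    (\<forall>\<^sub>F (j1, j2) in at (0, 0).
       (\<lambda>h. I1 h j2) field_differentiable at (\<H> (j1, j2)) \<and>
       (\<lambda>x. S (x, j2)) field_differentiable at j1 \<and>
       (\<lambda>x. \<H> (x, j2)) field_differentiable at j1 \<and>
       partial1 \<H> (j1, j2) \<noteq> 0 \<and>
       period \<H> (j1, j2) =
         (- ln (norm (jhat (j1, j2))) + partial1 S (j1, j2)) / partial1 \<H> (j1, j2) \<and>
       - ln (norm (jhat (j1, j2))) + partial1 S (j1, j2) =
         ln (32 / norm (jhat (j1, j2))) + 3 / 16 * j1 + R (j1, j2) \<and>
       partial1 \<H> (j1, j2) = 1 + 1 / 8 * j1 + Q (j1, j2) \<and>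
       period \<H> (j1, j2) =
         (ln (32 / norm (jhat (j1, j2))) + 3 / 16 * j1 + R (j1, j2))
           / (1 + 1 / 8 * j1 + Q (j1, j2)))"
proof -
  have "bigO_deg 2 (\<lambda>j. \<H> j - fst j)"
    using assms(1) by (simp add: eliasson_coordinates_def)
  then obtain b where b: "power_series2 b (\<lambda>j. \<H> j - fst j)" "\<And>m n. m + n < 2 \<Longrightarrow> b (m, n) = 0"
    unfolding bigO_deg_iff by blast
  define a where "a p = b p + (if p = (1, 0) then 1 else 0)" for p
  have H: "power_series2 a \<H>"
    using power_series2_add[OF b(1) power_series2_monomial[of 1 0 1]] by (simp add: a_def[abs_def])
  have a: "a (0, 0) = 0" "a (1, 0) = 1" "a (0, 1) = 0"
    by (simp_all add: a_def b(2))
  obtain s where S: "power_series2 s S"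
    using assms(2) unfolding semi_global_invariant_def real_analytic_at_0_iff by blast
  have action: "\<forall>\<^sub>F z in nhds 0. z \<noteq> 0 \<longrightarrow> 2 * pi * I1 (\<H> z) (snd z)
           = 8 - 2 * pi * \<bar>snd z\<bar> + singular_action (snd z) (fst z) + S z"
  proof -
    have "\<forall>\<^sub>F (j1, j2) in at 0.
        2 * pi * I1 (\<H> (j1, j2)) j2 =
          8 - 2 * pi * \<bar>j2\<bar> + j2 * Arg (jhat (j1, j2)) - j1 * ln (norm (jhat (j1, j2)))
            + j1 + S (j1, j2)"
      using assms(2) unfolding semi_global_invariant_def by blast
    then show ?thesis
      unfolding eventually_at_filter
      by (rule eventually_mono) (auto simp: singular_action_def jhat_def)
  qed
  have "\<forall>\<^sub>F t in at_right 0. 2 * pi * I1 (\<H> (t, 0)) 0 = 8 + singular_action 0 t + S (t, 0)"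
  proof -
    have "filterlim (\<lambda>t::real. (t, 0 :: real)) (nhds 0) (at_right 0)"
      unfolding zero_prod_def by (auto intro!: tendsto_eq_intros)
    from eventually_compose_filterlim[OF action this] eventually_at_right_less[of 0]
    show ?thesis by eventually_elim (simp add: zero_prod_def)
  qed
  note on = coeffs_on_axis[OF H a(1,2) S this]
  note off = coeffs_off_axis[OF H a S action]
  note dH = power_series2_partial1[OF H] and dS = power_series2_partial1[OF S]
  define R where "R z = partial1 S z - ln 32 - 3 / 16 * fst z" for z
  define Q where "Q z = partial1 \<H> z - 1 - 1 / 8 * fst z" for z
  have low: "p \<in> {(0, 0), (1, 0), (0, 1)}" if "fst p + snd p < 2" for p :: "nat \<times> nat"
    using that by (cases p) auto
  have R: "bigO_deg 2 R"
  proof -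
    have "R = (\<lambda>z. partial1 S z + - ln 32 * fst z ^ 0 * snd z ^ 0 + - (3 / 16) * fst z ^ 1 * snd z ^ 0)"
      by (simp add: R_def fun_eq_iff)
    then have ps: "power_series2 (\<lambda>p. (\<lambda>(m, n). real (Suc m) * s (Suc m, n)) p + (if p = (0, 0) then - ln 32 else 0)
             + (if p = (1, 0) then - (3 / 16) else 0)) R"
      by (simp only: power_series2_add[OF power_series2_add[OF dS(1) power_series2_monomial] power_series2_monomial])
    show ?thesis
      unfolding bigO_deg_iff
    proof (rule exI, rule conjI[OF ps], intro allI impI)
      fix m n :: nat
      assume "m + n < 2"
      with low[of "(m, n)"] on off show "(\<lambda>(m, n). real (Suc m) * s (Suc m, n)) (m, n)
          + (if (m, n) = (0, 0) then - ln 32 else 0) + (if (m, n) = (1, 0) then - (3 / 16) else 0) = 0"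
        by (auto simp: numeral_2_eq_2)
    qed
  qed
  have Q: "bigO_deg 2 Q"
  proof -
    have "Q = (\<lambda>z. partial1 \<H> z + - 1 * fst z ^ 0 * snd z ^ 0 + - (1 / 8) * fst z ^ 1 * snd z ^ 0)"
      by (simp add: Q_def fun_eq_iff)
    then have ps: "power_series2 (\<lambda>p. (\<lambda>(m, n). real (Suc m) * a (Suc m, n)) p + (if p = (0, 0) then - 1 else 0)
             + (if p = (1, 0) then - (1 / 8) else 0)) Q"
      by (simp only: power_series2_add[OF power_series2_add[OF dH(1) power_series2_monomial] power_series2_monomial])
    show ?thesis
      unfolding bigO_deg_iff
    proof (rule exI, rule conjI[OF ps], intro allI impI)
      fix m n :: nat
      assume "m + n < 2"
      with low[of "(m, n)"] a on off show "(\<lambda>(m, n). real (Suc m) * a (Suc m, n)) (m, n)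
          + (if (m, n) = (0, 0) then - 1 else 0) + (if (m, n) = (1, 0) then - (1 / 8) else 0) = 0"
        by (auto simp: numeral_2_eq_2)
    qed
  qed
  have "(partial1 \<H> \<longlongrightarrow> 1) (nhds 0)"
    using power_series2_tendsto[OF dH(1)] a by simp
  then have posH: "\<forall>\<^sub>F z in nhds 0. partial1 \<H> z > 0"
    by (rule order_tendstoD) simp
  have "\<forall>\<^sub>F z in nhds 0. partial1 \<H> z > 0 \<and>
      ((\<lambda>x. \<H> (x, snd z)) has_real_derivative partial1 \<H> z) (at (fst z)) \<and>
      ((\<lambda>x. S (x, snd z)) has_real_derivative partial1 S z) (at (fst z)) \<and>
      (z \<noteq> 0 \<longrightarrow> 2 * pi * I1 (\<H> z) (snd z)
           = 8 - 2 * pi * \<bar>snd z\<bar> + singular_action (snd z) (fst z) + S z)"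
    using posH dH(2) dS(2) action by eventually_elim blast
  then obtain r where r: "r > 0" and
    box: "\<And>x y. \<bar>x\<bar> \<le> r \<Longrightarrow> \<bar>y\<bar> \<le> r \<Longrightarrow> partial1 \<H> (x, y) > 0 \<and>
      ((\<lambda>x. \<H> (x, y)) has_real_derivative partial1 \<H> (x, y)) (at x) \<and>
      ((\<lambda>x. S (x, y)) has_real_derivative partial1 S (x, y)) (at x) \<and>
      ((x, y) \<noteq> 0 \<longrightarrow> 2 * pi * I1 (\<H> (x, y)) y
           = 8 - 2 * pi * \<bar>y\<bar> + singular_action y x + S (x, y))"
    unfolding eventually_nhds_0_box by auto
  have deriv: "((\<lambda>h. I1 h y) has_real_derivative
          (- ln (norm (Complex x y)) + partial1 S (x, y)) / (2 * pi) / partial1 \<H> (x, y)) (at (\<H> (x, y)))"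
    if xy: "\<bar>x\<bar> < r" "\<bar>y\<bar> \<le> r" "(x, y) \<noteq> (0, 0)" for x y
  proof -
    \<comment> \<open>The line at height \<open>y\<close>, without the origin when \<open>y = 0\<close>, as the action formula says nothing there.\<close>
    define T where "T = {u. \<bar>u\<bar> < r \<and> (u, y) \<noteq> (0, 0)}"
    have "T = {- r<..<r} - (if y = 0 then {0} else {})"
      by (auto simp: T_def abs_less_iff)
    then have "open T" by (auto intro!: open_Diff)
    moreover have "x \<in> T" using xy by (simp add: T_def)
    moreover have "inj_on (\<lambda>x. \<H> (x, y)) T"
    proof (rule linorder_inj_onI')
      fix u v
      assume uv: "u \<in> T" "v \<in> T" "u < v"
      have "\<H> (u, y) < \<H> (v, y)"
      proof (rule DERIV_pos_imp_increasing[OF uv(3)])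
        fix w assume "u \<le> w" "w \<le> v"
        then have "\<bar>w\<bar> \<le> r" using uv by (auto simp: T_def)
        then show "\<exists>d. ((\<lambda>x. \<H> (x, y)) has_real_derivative d) (at w) \<and> d > 0"
          using box[of w y] xy(2) by blast
      qed
      then show "\<H> (u, y) \<noteq> \<H> (v, y)" by simp
    qed
    moreover have "((\<lambda>x. \<H> (x, y)) has_real_derivative partial1 \<H> (u, y)) (at u)" if "u \<in> T" for u
      using box[of u y] that xy(2) by (simp add: T_def)
    moreover have "partial1 \<H> (x, y) \<noteq> 0"
      using box[of x y] xy by simp
    moreover have "((\<lambda>u. (8 - 2 * pi * \<bar>y\<bar> + singular_action y u + S (u, y)) / (2 * pi)) has_real_derivative
        (- ln (norm (Complex x y)) + partial1 S (x, y)) / (2 * pi)) (at x)"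
    proof -
      have "((\<lambda>u. 8 - 2 * pi * \<bar>y\<bar> + singular_action y u + S (u, y)) has_real_derivative
        0 + - ln (norm (Complex x y)) + partial1 S (x, y)) (at x)"
        using box[of x y] xy by (intro DERIV_add DERIV_const DERIV_singular_action) auto
      from DERIV_cdivide[OF this, of "2 * pi"] show ?thesis by simp
    qed
    moreover have "I1 (\<H> (u, y)) y = (8 - 2 * pi * \<bar>y\<bar> + singular_action y u + S (u, y)) / (2 * pi)"
      if "u \<in> T" for u
      using box[of u y] that xy(2) by (simp add: T_def zero_prod_def field_simps)
    ultimately show ?thesis
      by (rule DERIV_factor_through_inverse[where f = "\<lambda>x. \<H> (x, y)" and G = "\<lambda>h. I1 h y"
            and f' = "\<lambda>x. partial1 \<H> (x, y)"])
  qed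
  have "\<forall>\<^sub>F z in nhds 0. \<bar>fst z\<bar> < r \<and> \<bar>snd z\<bar> \<le> r"
    unfolding eventually_nhds_0_box by (rule exI[of _ "r / 2"]) (use r in auto)
  then have "\<forall>\<^sub>F z in at (0, 0). z \<noteq> (0, 0) \<and> \<bar>fst z\<bar> < r \<and> \<bar>snd z\<bar> \<le> r"
    unfolding zero_prod_def eventually_at_filter by (auto elim: eventually_mono)
  then have "\<forall>\<^sub>F (j1, j2) in at (0, 0).
       (\<lambda>h. I1 h j2) field_differentiable at (\<H> (j1, j2)) \<and>
       (\<lambda>x. S (x, j2)) field_differentiable at j1 \<and>
       (\<lambda>x. \<H> (x, j2)) field_differentiable at j1 \<and>
       partial1 \<H> (j1, j2) \<noteq> 0 \<and>
       period \<H> (j1, j2) =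
         (- ln (norm (jhat (j1, j2))) + partial1 S (j1, j2)) / partial1 \<H> (j1, j2) \<and>
       - ln (norm (jhat (j1, j2))) + partial1 S (j1, j2) =
         ln (32 / norm (jhat (j1, j2))) + 3 / 16 * j1 + R (j1, j2) \<and>
       partial1 \<H> (j1, j2) = 1 + 1 / 8 * j1 + Q (j1, j2) \<and>
       period \<H> (j1, j2) =
         (ln (32 / norm (jhat (j1, j2))) + 3 / 16 * j1 + R (j1, j2))
           / (1 + 1 / 8 * j1 + Q (j1, j2))"
  proof eventually_elim
    case (elim z)
    obtain x y where z: "z = (x, y)" by (cases z)
    have xy: "\<bar>x\<bar> < r" "\<bar>y\<bar> \<le> r" "(x, y) \<noteq> (0, 0)" using elim by (auto simp: z)
    note b = box[OF less_imp_le[OF xy(1)] xy(2)] and d = deriv[OF xy]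
    have "period \<H> (x, y) = 2 * pi *
        ((- ln (norm (Complex x y)) + partial1 S (x, y)) / (2 * pi) / partial1 \<H> (x, y))"
      using DERIV_imp_deriv[OF d] by (simp add: period_def)
    then have T: "period \<H> (x, y) = (- ln (norm (jhat (x, y))) + partial1 S (x, y)) / partial1 \<H> (x, y)"
      by (simp add: jhat_def)
    have "norm (jhat (x, y)) > 0" using xy(3) by (auto simp: jhat_def complex_eq_iff)
    then have 1: "- ln (norm (jhat (x, y))) + partial1 S (x, y) =
         ln (32 / norm (jhat (x, y))) + 3 / 16 * x + R (x, y)"
      by (simp add: R_def ln_div)
    have 2: "partial1 \<H> (x, y) = 1 + 1 / 8 * x + Q (x, y)" by (simp add: Q_def)
    show ?case
      unfolding z prod.case
      using b d T T[unfolded 1 2] 1 2 unfolding field_differentiable_def by (intro conjI) auto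
  qed
  with R Q show ?thesis by blast
qed

end
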